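(* Let $\mu\in\mathrm{VConv}_k(\mathbb{R}^n)$ and let $E\subset\mathbb{R}^n$ be a $k$-dimensional linear subspace with complexification $E_{\mathbb{C}}:=E\otimes_{\mathbb{R}}\mathbb{C}\subset\mathbb{C}^n$. Then $\mathcal{F}(\mathrm{GW}(\mu))[w_1,\dots,w_k]=0$ for all $w_1,\dots,w_k\in E_{\mathbb{C}}$ if and only if $\pi_{E*}\mu=0$.
   Context: For a finite-dimensional real vector space $V$, $\mathrm{Conv}(V,\mathbb{R})$ is the space of finite-valued convex functions $V\to\mathbb{R}$ with the topology of uniform convergence on compact subsets. A map $\mu:\mathrm{Conv}(V,\mathbb{R})\to\mathbb{R}$ is a valuation if $\mu(f)+\mu(h)=\mu(f\vee h)+\mu(f\wedge h)$ whenever $f,h$ and the pointwise maximum $f\vee h$ and minimum $f\wedge h$ belong to $\mathrm{Conv}(V,\mathbb{R})$. It is dually epi-translation invariant if $\mu(f+\ell)=\mu(f)$ for all affine $\ell:V\to\mathbb{R}$. $\mathrm{VConv}(V)$ is the space of continuous, dually epi-translation invariant valuations, $\mathrm{VConv}_k(V)$ the subspace of $k$-homogeneous ones ($\mu(tf)=t^k\mu(f)$ for $t\ge0$). For a subspace $E\subset\mathbb{R}^n$ with orthogonal projection $\pi_E:\mathbb{R}^n\to E$, $[\pi_{E*}\mu](f):=\mu(f\circ\pi_E)$ for $f\in\mathrm{Conv}(E,\mathbb{R})$. For $\mu\in\mathrm{VConv}_k(V)$ the polarization is $\bar\mu(f_1,\dots,f_k):=\frac{1}{k!}\frac{\partial}{\partial\lambda_1}\big|_0\cdots\frac{\partial}{\partial\lambda_k}\big|_0\mu\left(\sum_{i=1}^k\lambda_if_i\right)$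 for $f_i\in\mathrm{Conv}(V,\mathbb{R})$ (with $\lambda_i\geq 0$). The Goodey–Weil distribution $\mathrm{GW}(\mu)\in\mathcal{D}'(V^k)$ is the unique compactly supported distribution with $\mathrm{GW}(\mu)[f_1\otimes\dots\otimes f_k]=\bar\mu(f_1,\dots,f_k)$ for all $f_1,\dots,f_k\in\mathrm{Conv}(V,\mathbb{R})\cap C^\infty(V)$ (its existence and uniqueness are known). For $V=\mathbb{R}^n$ its Fourier–Laplace transform is the entire function on $(\mathbb{C}^n)^k$ given by $$\mathcal{F}(\mathrm{GW}(\mu))[w_1,\dots,w_k]=\mathrm{GW}(\mu)[\exp(-i(w_1,\cdot))\otimes\dots\otimes\exp(-i(w_k,\cdot))],$$ where $(\cdot,\cdot)$ is the $\mathbb{C}$-bilinear extension of the standard scalar product of $\mathbb{R}^n$. *)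

theory Defs
  imports "HOL-Analysis.Analysis"
begin

section \<open>Convex functions and valuations\<close>

text \<open>For a linear subspace \<open>S\<close>, elements of \<open>Conv S\<close> represent finite convex functions on \<open>S\<close>;
  their values off \<open>S\<close> carry no meaning.\<close>

definition Conv :: "'a::euclidean_space set \<Rightarrow> ('a \<Rightarrow> real) set" where
  "Conv S = {f. convex_on S f}"

definition conv_open :: "('a::euclidean_space \<Rightarrow> real) set \<Rightarrow> bool" where
  "conv_open U \<longleftrightarrow> U \<subseteq> Conv UNIV \<and>
     (\<forall>f\<in>U. \<exists>K \<epsilon>. compact K \<and> \<epsilon> > 0 \<and>
        {h \<in> Conv UNIV. \<forall>x\<in>K. \<bar>h x - f x\<bar> < \<epsilon>} \<subseteq> U)"

text \<open>The topology of uniform convergence on compact subsets.\<close>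

definition conv_topology :: "('a::euclidean_space \<Rightarrow> real) topology" where
  "conv_topology = topology conv_open"

lemma istopology_conv_open: "istopology conv_open"
proof -
  have "conv_open (S \<inter> T)" if S: "conv_open S" and T: "conv_open T"
    for S T :: "('a \<Rightarrow> real) set"
    unfolding conv_open_def
  proof (intro conjI ballI)
    show "S \<inter> T \<subseteq> Conv UNIV"
      using S unfolding conv_open_def by blast
    fix f assume f: "f \<in> S \<inter> T"
    then have "f \<in> S" "f \<in> T" by simp_all
    obtain K a where K: "compact K" "a > 0"
      "{h \<in> Conv UNIV. \<forall>x\<in>K. \<bar>h x - f x\<bar> < a} \<subseteq> S"
      using bspec[OF conjunct2[OF S[unfolded conv_open_def]] \<open>f \<in> S\<close>] by (elim exE conjE)
    obtain L b where L: "compact L" "b > 0"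
      "{h \<in> Conv UNIV. \<forall>x\<in>L. \<bar>h x - f x\<bar> < b} \<subseteq> T"
      using bspec[OF conjunct2[OF T[unfolded conv_open_def]] \<open>f \<in> T\<close>] by (elim exE conjE)
    show "\<exists>K \<epsilon>. compact K \<and> \<epsilon> > 0 \<and>
        {h \<in> Conv UNIV. \<forall>x\<in>K. \<bar>h x - f x\<bar> < \<epsilon>} \<subseteq> S \<inter> T"
    proof (rule exI[of _ "K \<union> L"], rule exI[of _ "min a b"], intro conjI)
      show "compact (K \<union> L)" using K(1) L(1) by (rule compact_Un)
      show "min a b > 0" using K(2) L(2) by simp
      show "{h \<in> Conv UNIV. \<forall>x\<in>K \<union> L. \<bar>h x - f x\<bar> < min a b} \<subseteq> S \<inter> T"
      proof
        fix h assume h: "h \<in> {h \<in> Conv UNIV. \<forall>x\<in>K \<union> L. \<bar>h x - f x\<bar> < min a b}"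
        then have "h \<in> {h \<in> Conv UNIV. \<forall>x\<in>K. \<bar>h x - f x\<bar> < a}"
          "h \<in> {h \<in> Conv UNIV. \<forall>x\<in>L. \<bar>h x - f x\<bar> < b}" by simp_all
        then show "h \<in> S \<inter> T" using K(3) L(3) by blast
      qed
    qed
  qed
  moreover have "conv_open (\<Union>\<K>)" if \<K>: "\<forall>S\<in>\<K>. conv_open S"
    for \<K> :: "('a \<Rightarrow> real) set set"
    unfolding conv_open_def
  proof (intro conjI ballI)
    show "\<Union>\<K> \<subseteq> Conv UNIV"
      using \<K> unfolding conv_open_def by blast
    fix f assume "f \<in> \<Union>\<K>"
    then obtain S where S: "S \<in> \<K>" "f \<in> S" by blast
    then have "conv_open S" using \<K> by blast
    then obtain K a where K: "compact K" "a > 0"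
      "{h \<in> Conv UNIV. \<forall>x\<in>K. \<bar>h x - f x\<bar> < a} \<subseteq> S"
      using bspec[OF conjunct2[OF \<open>conv_open S\<close>[unfolded conv_open_def]] S(2)]
      by (elim exE conjE)
    have "{h \<in> Conv UNIV. \<forall>x\<in>K. \<bar>h x - f x\<bar> < a} \<subseteq> \<Union>\<K>"
      using K(3) Union_upper[OF S(1)] by (rule subset_trans)
    with K(1,2) show "\<exists>K \<epsilon>. compact K \<and> \<epsilon> > 0 \<and>
        {h \<in> Conv UNIV. \<forall>x\<in>K. \<bar>h x - f x\<bar> < \<epsilon>} \<subseteq> \<Union>\<K>"
      by (intro exI conjI)
  qed
  ultimately show ?thesis
    unfolding istopology_def by simp
qed

lemma openin_conv_topology: "openin conv_topology = conv_open"
  unfolding conv_topology_def using istopology_conv_open by (rule topology_inverse')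

lemma topspace_conv_topology: "topspace conv_topology = Conv UNIV"
proof
  show "topspace conv_topology \<subseteq> Conv UNIV"
    using openin_topspace[of conv_topology] unfolding openin_conv_topology conv_open_def
    by (rule conjunct1)
  have "conv_open (Conv UNIV :: ('a \<Rightarrow> real) set)"
    unfolding conv_open_def
    by (rule conjI[OF subset_refl], rule ballI, rule exI[of _ "{}"], rule exI[of _ 1], simp)
  then show "Conv UNIV \<subseteq> (topspace conv_topology :: ('a \<Rightarrow> real) set)"
    using openin_subset[of conv_topology] unfolding openin_conv_topology by blast
qed

definition valuation_on_Conv :: "(('a::euclidean_space \<Rightarrow> real) \<Rightarrow> real) \<Rightarrow> bool" where
  "valuation_on_Conv \<mu> \<longleftrightarrow>
     (\<forall>f h. f \<in> Conv UNIV \<longrightarrow> h \<in> Conv UNIV \<longrightarrow>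
        (\<lambda>x. max (f x) (h x)) \<in> Conv UNIV \<longrightarrow> (\<lambda>x. min (f x) (h x)) \<in> Conv UNIV \<longrightarrow>
        \<mu> f + \<mu> h = \<mu> (\<lambda>x. max (f x) (h x)) + \<mu> (\<lambda>x. min (f x) (h x)))"

definition dually_epi_translation_invariant ::
    "(('a::euclidean_space \<Rightarrow> real) \<Rightarrow> real) \<Rightarrow> bool" where
  "dually_epi_translation_invariant \<mu> \<longleftrightarrow>
     (\<forall>f\<in>Conv UNIV. \<forall>l c. linear l \<longrightarrow> \<mu> (\<lambda>x. f x + (l x + c)) = \<mu> f)"

definition VConv :: "(('a::euclidean_space \<Rightarrow> real) \<Rightarrow> real) set" where
  "VConv = {\<mu>. valuation_on_Conv \<mu> \<and> dually_epi_translation_invariant \<mu> \<and>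
               continuous_map conv_topology euclideanreal \<mu>}"

definition VConv_hom :: "nat \<Rightarrow> (('a::euclidean_space \<Rightarrow> real) \<Rightarrow> real) set" where
  "VConv_hom k = {\<mu> \<in> VConv. \<forall>f\<in>Conv UNIV. \<forall>t\<ge>0. \<mu> (\<lambda>x. t * f x) = t ^ k * \<mu> f}"

definition orth_proj :: "'a::euclidean_space set \<Rightarrow> 'a \<Rightarrow> 'a" where
  "orth_proj E x = (THE y. y \<in> E \<and> (\<forall>z\<in>E. orthogonal (x - y) z))"

definition pushforward ::
    "'a::euclidean_space set \<Rightarrow> (('a \<Rightarrow> real) \<Rightarrow> real) \<Rightarrow> ('a \<Rightarrow> real) \<Rightarrow> real" where
  "pushforward E \<mu> f = \<mu> (f \<circ> orth_proj E)"

section \<open>Polarization\<close>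

text \<open>Indices run over \<open>0, \<dots>, k - 1\<close>. As sums \<open>\<Sum>i<k. \<lambda>\<^sub>i f\<^sub>i\<close> are only guaranteed to be
  convex for nonnegative \<open>\<lambda>\<^sub>i\<close>, the derivatives at 0 are one-sided.\<close>

definition right_partial0 :: "nat \<Rightarrow> ((nat \<Rightarrow> real) \<Rightarrow> real) \<Rightarrow> (nat \<Rightarrow> real) \<Rightarrow> real" where
  "right_partial0 j F c = vector_derivative (\<lambda>t. F (c(j := t))) (at 0 within {0..})"

definition polarization ::
    "nat \<Rightarrow> (('a::euclidean_space \<Rightarrow> real) \<Rightarrow> real) \<Rightarrow> (nat \<Rightarrow> 'a \<Rightarrow> real) \<Rightarrow> real" where
  "polarization k \<mu> f =
     1 / fact k *
     foldr right_partial0 [0..<k] (\<lambda>c. \<mu> (\<lambda>x. \<Sum>i<k. c i * f i x)) (\<lambda>_. 0)"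

section \<open>Smooth functions\<close>

definition dir_deriv ::
    "'a::euclidean_space \<Rightarrow> ('a \<Rightarrow> 'b::real_normed_vector) \<Rightarrow> 'a \<Rightarrow> 'b" where
  "dir_deriv v f x = vector_derivative (\<lambda>t. f (x + t *\<^sub>R v)) (at 0)"

text \<open>All iterated partial derivatives exist and are continuous.\<close>

definition smooth :: "('a::euclidean_space \<Rightarrow> 'b::real_normed_vector) \<Rightarrow> bool" where
  "smooth f \<longleftrightarrow>
     (\<forall>vs\<in>lists Basis.
        continuous_on UNIV (foldr dir_deriv vs f) \<and>
        (\<forall>v\<in>Basis. \<forall>x. (\<lambda>t. foldr dir_deriv vs f (x + t *\<^sub>R v)) differentiable (at 0)))"

text \<open>The power \<open>V\<^sup>k\<close> is modelled by the extensional functions on \<open>{..<k}\<close>, which allows an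
  arbitrary natural number \<open>k\<close>, including 0. The ambient function type carries
  the product topology.\<close>

definition power_space :: "nat \<Rightarrow> (nat \<Rightarrow> 'a::euclidean_space) set" where
  "power_space k = ({..<k} \<rightarrow>\<^sub>E UNIV)"

text \<open>The derivative in the direction \<open>v\<close> of the \<open>j\<close>-th copy of \<open>V\<close>.\<close>

definition slot_deriv :: "nat \<times> 'a::euclidean_space \<Rightarrow> ((nat \<Rightarrow> 'a) \<Rightarrow> complex) \<Rightarrow>
    (nat \<Rightarrow> 'a) \<Rightarrow> complex" where
  "slot_deriv = (\<lambda>(j, v) \<phi> x.
     vector_derivative (\<lambda>t. \<phi> (x(j := x j + t *\<^sub>R v))) (at 0))"

definition smooth_power :: "nat \<Rightarrow> ((nat \<Rightarrow> 'a::euclidean_space) \<Rightarrow> complex) \<Rightarrow> bool" where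
  "smooth_power k \<phi> \<longleftrightarrow>
     (\<forall>ds\<in>lists ({..<k} \<times> Basis).
        continuous_on (power_space k) (foldr slot_deriv ds \<phi>) \<and>
        (\<forall>j<k. \<forall>v\<in>Basis. \<forall>x\<in>power_space k.
           (\<lambda>t. foldr slot_deriv ds \<phi> (x(j := x j + t *\<^sub>R v))) differentiable (at 0)))"

section \<open>Compactly supported distributions\<close>

text \<open>A compactly supported distribution on \<open>V\<^sup>k\<close> is evaluated on arbitrary smooth functions
  through its canonical extension from test functions to \<open>C\<^sup>\<infinity>(V\<^sup>k)\<close>, so it is represented
  as a continuous complex-linear functional on \<open>C\<^sup>\<infinity>(V\<^sup>k)\<close>. Continuity is the estimate by
  one of the defining seminorms: the supremum over a compact set of the derivatives of order
  at most \<open>N\<close>. It also makes \<open>T \<phi>\<close> depend only on the restriction of \<open>\<phi>\<close> to \<open>V\<^sup>k\<close>.\<close>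

definition compact_distribution ::
    "nat \<Rightarrow> (((nat \<Rightarrow> 'a::euclidean_space) \<Rightarrow> complex) \<Rightarrow> complex) \<Rightarrow> bool" where
  "compact_distribution k T \<longleftrightarrow>
     (\<forall>\<phi> \<psi>. smooth_power k \<phi> \<longrightarrow> smooth_power k \<psi> \<longrightarrow> T (\<lambda>x. \<phi> x + \<psi> x) = T \<phi> + T \<psi>) \<and>
     (\<forall>c \<phi>. smooth_power k \<phi> \<longrightarrow> T (\<lambda>x. c * \<phi> x) = c * T \<phi>) \<and>
     (\<exists>K C N. compact K \<and> K \<subseteq> power_space k \<and> C \<ge> 0 \<and>
        (\<forall>\<phi> M. smooth_power k \<phi> \<longrightarrow> M \<ge> 0 \<longrightarrow>
           (\<forall>ds\<in>lists ({..<k} \<times> Basis). length ds \<le> N \<longrightarrow>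
              (\<forall>x\<in>K. cmod (foldr slot_deriv ds \<phi> x) \<le> M)) \<longrightarrow>
           cmod (T \<phi>) \<le> C * M))"

definition tensor :: "nat \<Rightarrow> (nat \<Rightarrow> 'a \<Rightarrow> complex) \<Rightarrow> (nat \<Rightarrow> 'a) \<Rightarrow> complex" where
  "tensor k g x = (\<Prod>j<k. g j (x j))"

text \<open>\<open>T\<close> is the Goodey--Weil distribution of \<open>\<mu>\<close>. The defining property determines \<open>T\<close>
  uniquely on smooth functions, but not as a function on the whole type, hence a predicate.\<close>

definition is_Goodey_Weil :: "nat \<Rightarrow> (('a::euclidean_space \<Rightarrow> real) \<Rightarrow> real) \<Rightarrow>
    (((nat \<Rightarrow> 'a) \<Rightarrow> complex) \<Rightarrow> complex) \<Rightarrow> bool" where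
  "is_Goodey_Weil k \<mu> T \<longleftrightarrow>
     compact_distribution k T \<and>
     (\<forall>f. (\<forall>i<k. f i \<in> Conv UNIV \<and> smooth (f i)) \<longrightarrow>
        T (tensor k (\<lambda>i x. complex_of_real (f i x))) = complex_of_real (polarization k \<mu> f))"

section \<open>The Fourier--Laplace transform\<close>

definition bilin :: "complex ^ 'n \<Rightarrow> complex ^ 'n \<Rightarrow> complex" where
  "bilin w z = (\<Sum>a\<in>UNIV. w $ a * z $ a)"

definition embed :: "real ^ 'n \<Rightarrow> complex ^ 'n" where
  "embed x = (\<chi> a. complex_of_real (x $ a))"

definition Fourier_Laplace :: "nat \<Rightarrow> (((nat \<Rightarrow> real ^ 'n) \<Rightarrow> complex) \<Rightarrow> complex) \<Rightarrow>
    (nat \<Rightarrow> complex ^ 'n) \<Rightarrow> complex" where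
  "Fourier_Laplace k T w = T (tensor k (\<lambda>j x. exp (- \<i> * bilin (w j) (embed x))))"

text \<open>\<open>E \<otimes> \<complex>\<close> as the subset \<open>E + \<i> E\<close> of \<open>\<complex>\<^sup>n\<close>.\<close>

definition complexification :: "(real ^ 'n) set \<Rightarrow> (complex ^ 'n) set" where
  "complexification E = {embed u + \<i> *s embed v | u v. u \<in> E \<and> v \<in> E}"

end

theory Submission
  imports Defs
begin

text \<open>Only multilinearity of the Goodey--Weil distribution \<open>T\<close> on tensor products of exponential
  sums is needed. On the diagonal the polarization of a \<open>k\<close>-homogeneous \<open>\<mu>\<close> returns \<open>\<mu>\<close>, so if \<open>T\<close>
  vanishes on products of exponentials with frequencies in \<open>E\<close>, then \<open>\<mu>\<close> vanishes on every convex
  exponential sum with such frequencies. These sums are locally uniformly dense among the convex functions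
  factoring through \<open>\<pi>\<^sub>E\<close>: approximate first by a maximum of affine functions, then by the logarithm
  of a sum of exponentials, and finally replace the logarithm by an odd-degree truncation of its power
  series, which keeps the function convex on the whole space. Conversely, an exponential with complex
  frequency in \<open>E\<close> is a complex combination of convex exponential sums factoring through \<open>\<pi>\<^sub>E\<close>,
  and on tensor products of the latter \<open>T\<close> is a polarization involving only values of \<open>\<pi>\<^sub>E\<^sub>*\<mu>\<close>.\<close>

section \<open>Exponential sums\<close>

text \<open>The complex linear span, given inductively so that linearity arguments become inductions
  over three rules. There is no rule for zero: the span of the empty set is empty, which is why sums
  are taken over nonempty index sets.\<close>

inductive_set cspan :: "('a \<Rightarrow> complex) set \<Rightarrow> ('a \<Rightarrow> complex) set" for B where
  base: "g \<in> B \<Longrightarrow> g \<in> cspan B"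
| add: "g \<in> cspan B \<Longrightarrow> h \<in> cspan B \<Longrightarrow> (\<lambda>x. g x + h x) \<in> cspan B"
| scale: "g \<in> cspan B \<Longrightarrow> (\<lambda>x. c * g x) \<in> cspan B"

lemma cspan_subset:
  assumes "B \<subseteq> cspan C"
  shows "cspan B \<subseteq> cspan C"
proof
  fix g assume "g \<in> cspan B"
  then show "g \<in> cspan C"
    by induction (use assms in \<open>auto intro: cspan.intros\<close>)
qed

lemma cspan_sum:
  assumes "finite I" "I \<noteq> {}" "\<And>i. i \<in> I \<Longrightarrow> g i \<in> cspan B"
  shows "(\<lambda>x. \<Sum>i\<in>I. g i x) \<in> cspan B"
  using assms by (induction I rule: finite_ne_induct) (auto intro: cspan.add)

lemma cspan_mult:
  assumes B: "\<And>a b. a \<in> B \<Longrightarrow> b \<in> B \<Longrightarrow> (\<lambda>x. a x * b x) \<in> B"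
    and "g \<in> cspan B" "h \<in> cspan B"
  shows "(\<lambda>x. g x * h x) \<in> cspan B"
  using assms(2)
proof induction
  case (base g)
  show ?case
    using assms(3)
  proof induction
    case (base h)
    then show ?case using B \<open>g \<in> B\<close> by (auto intro: cspan.base)
  next
    case (add h1 h2)
    then show ?case using cspan.add[OF add.IH] by (simp add: distrib_left)
  next
    case (scale h c)
    then show ?case using cspan.scale[OF scale.IH, of c] by (simp add: mult.left_commute)
  qed
next
  case (add g1 g2)
  then show ?case using cspan.add[OF add.IH] by (simp add: distrib_right)
next
  case (scale g c)
  then show ?case using cspan.scale[OF scale.IH, of c] by (simp add: mult.assoc)
qed

definition exps :: "('a \<Rightarrow> complex) set \<Rightarrow> ('a \<Rightarrow> complex) set" where
  "exps L = {\<lambda>x. exp (l x) | l. l \<in> L}"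

abbreviation exp_sums :: "('a::euclidean_space \<Rightarrow> complex) set" where
  "exp_sums \<equiv> cspan (exps {l. linear l})"

lemma cspan_exps_subset: "L \<subseteq> {l. linear l} \<Longrightarrow> cspan (exps L) \<subseteq> exp_sums"
  by (intro cspan_subset subsetI) (auto simp: exps_def intro!: cspan.base)

text \<open>The exponential of a linear form is an eigenfunction of each directional derivative,
  with eigenvalue \<open>l v\<close>. The class is thus closed under differentiation, and smoothness
  follows by iteration.\<close>

lemma exp_sums_derivative:
  assumes "g \<in> exp_sums"
  shows "\<exists>g'\<in>exp_sums. \<forall>x. ((\<lambda>t. g (x + t *\<^sub>R v)) has_vector_derivative g' x) (at 0)"
  using assms
proof induction
  case (base g)
  then obtain l where g: "g = (\<lambda>x. exp (l x))" and l: "linear l"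
    by (auto simp: exps_def)
  have "((\<lambda>t. g (x + t *\<^sub>R v)) has_vector_derivative l v * g x) (at 0)" for x
  proof -
    have "((\<lambda>t. exp (l x + t * l v)) has_field_derivative l v * exp (l x)) (at (of_real 0))"
      by (auto intro!: derivative_eq_intros)
    from has_vector_derivative_real_field[OF this] show ?thesis
      by (simp add: g linear_add[OF l] linear_scale[OF l] scaleR_conv_of_real)
  qed
  moreover have "(\<lambda>x. l v * g x) \<in> exp_sums"
    using base by (intro cspan.scale cspan.base)
  ultimately show ?case by (intro bexI[of _ "\<lambda>x. l v * g x"]) auto
next
  case (add g h)
  then obtain g' h' where "g' \<in> exp_sums" "h' \<in> exp_sums"
    "\<And>x. ((\<lambda>t. g (x + t *\<^sub>R v)) has_vector_derivative g' x) (at 0)"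
    "\<And>x. ((\<lambda>t. h (x + t *\<^sub>R v)) has_vector_derivative h' x) (at 0)" by blast
  then show ?case
    by (intro bexI[of _ "\<lambda>x. g' x + h' x"])
      (auto intro: has_vector_derivative_add cspan.add)
next
  case (scale g c)
  then obtain g' where "g' \<in> exp_sums"
    "\<And>x. ((\<lambda>t. g (x + t *\<^sub>R v)) has_vector_derivative g' x) (at 0)" by blast
  then show ?case
    by (intro bexI[of _ "\<lambda>x. c * g' x"])
      (auto intro: has_vector_derivative_mult_right cspan.scale)
qed

lemma continuous_on_exp_sums:
  assumes "g \<in> exp_sums"
  shows "continuous_on S g"
  using assms
  by induction
    (auto simp: exps_def linear_conv_bounded_linear intro!: continuous_intros
      intro: linear_continuous_on)

text \<open>Real parts commute with directional derivatives, so each iterated derivative is again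
  the real part of an exponential sum.\<close>

lemma smooth_Re_exp_sums:
  assumes "g \<in> exp_sums"
  shows "smooth (\<lambda>x. Re (g x))"
proof -
  have D: "\<exists>g'\<in>exp_sums. \<forall>x. ((\<lambda>t. Re (g (x + t *\<^sub>R v))) has_vector_derivative Re (g' x)) (at 0)"
    if "g \<in> exp_sums" for g :: "'a \<Rightarrow> complex" and v
    using exp_sums_derivative[OF that, of v] bounded_linear.has_vector_derivative[OF bounded_linear_Re]
    by blast
  have "\<exists>h\<in>exp_sums. foldr dir_deriv vs (\<lambda>x. Re (g x)) = (\<lambda>x. Re (h x))" for vs
  proof (induction vs)
    case Nil
    then show ?case using assms by auto
  next
    case (Cons v vs)
    then obtain h where h: "h \<in> exp_sums" "foldr dir_deriv vs (\<lambda>x. Re (g x)) = (\<lambda>x. Re (h x))"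
      by blast
    obtain h' where "h' \<in> exp_sums"
      "\<And>x. ((\<lambda>t. Re (h (x + t *\<^sub>R v))) has_vector_derivative Re (h' x)) (at 0)"
      using D[OF h(1)] by blast
    then show ?case
      by (intro bexI[of _ h']) (auto simp: h(2) dir_deriv_def[of v] vector_derivative_at)
  qed
  then obtain h where h: "\<And>vs. h vs \<in> exp_sums"
    "\<And>vs. foldr dir_deriv vs (\<lambda>x. Re (g x)) = (\<lambda>x. Re (h vs x))" by metis
  show ?thesis
    unfolding smooth_def h(2)
  proof (intro ballI conjI allI)
    fix vs v and x :: 'a
    show "continuous_on UNIV (\<lambda>x. Re (h vs x))"
      by (intro continuous_intros continuous_on_exp_sums h(1))
    show "(\<lambda>t. Re (h vs (x + t *\<^sub>R v))) differentiable (at 0)"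
      using D[OF h(1), of vs v] differentiableI_vector by blast
  qed
qed

section \<open>Tensor products of exponential sums and multilinearity\<close>

lemma tensor_cong: "(\<And>j. j < k \<Longrightarrow> g j = h j) \<Longrightarrow> tensor k g = tensor k h"
  by (auto simp: tensor_def fun_eq_iff intro!: prod.cong)

lemma tensor_upd:
  assumes "j < k"
  shows "tensor k (g(j := a)) x = a (x j) * (\<Prod>i\<in>{..<k} - {j}. g i (x i))"
proof -
  have "tensor k (g(j := a)) x = (g(j := a)) j (x j) * (\<Prod>i\<in>{..<k} - {j}. (g(j := a)) i (x i))"
    unfolding tensor_def using assms by (intro prod.remove) auto
  also have "\<dots> = a (x j) * (\<Prod>i\<in>{..<k} - {j}. g i (x i))"
    by (auto intro!: arg_cong2[of _ _ _ _ "(*)"] prod.cong)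
  finally show ?thesis .
qed

text \<open>Only the factor in slot \<open>j\<close> sees the moving coordinate, so the slot
  derivative differentiates this factor and keeps the tensor form. The argument can therefore be
  iterated.\<close>

lemma tensor_exp_sums_slot_derivative:
  assumes g: "\<forall>j<k. g j \<in> exp_sums" and j: "j < k"
  shows "\<exists>h. (\<forall>j<k. h j \<in> exp_sums) \<and>
    (\<forall>x. ((\<lambda>t. tensor k g (x(j := x j + t *\<^sub>R v))) has_vector_derivative tensor k h x) (at 0))"
proof -
  obtain g' where g': "g' \<in> exp_sums"
    and D: "\<And>x. ((\<lambda>t. g j (x + t *\<^sub>R v)) has_vector_derivative g' x) (at 0)"
    using exp_sums_derivative[of "g j" v] g j by blast
  \<comment> \<open>The trivial update \<open>g(j := g j)\<close> makes \<open>tensor_upd\<close>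
    applicable.\<close>
  have "tensor k g (x(j := x j + t *\<^sub>R v)) =
      g j (x j + t *\<^sub>R v) * (\<Prod>i\<in>{..<k} - {j}. g i (x i))" for x t
    using tensor_upd[OF j, of g "g j" "x(j := x j + t *\<^sub>R v)"] by simp
  then have "\<forall>x. ((\<lambda>t. tensor k g (x(j := x j + t *\<^sub>R v))) has_vector_derivative
      tensor k (g(j := g')) x) (at 0)"
    by (simp add: tensor_upd[OF j] has_vector_derivative_mult_left[OF D])
  then show ?thesis
    using g g' by (intro exI[of _ "g(j := g')"]) auto
qed

lemma smooth_power_tensor_exp_sums:
  assumes "\<forall>j<k. g j \<in> exp_sums"
  shows "smooth_power k (tensor k g)"
proof -
  have "\<exists>h. (\<forall>j<k. h j \<in> exp_sums) \<and> foldr slot_deriv ds (tensor k g) = tensor k h"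
    if "ds \<in> lists ({..<k} \<times> Basis)" for ds
    using that
  proof (induction ds)
    case Nil
    then show ?case using assms by auto
  next
    case (Cons d ds)
    then obtain h where h: "\<forall>j<k. h j \<in> exp_sums" "foldr slot_deriv ds (tensor k g) = tensor k h"
      by auto
    obtain j v where d: "d = (j, v)" "j < k" using Cons by auto
    obtain h' where "\<forall>j<k. h' j \<in> exp_sums"
      "\<And>x. ((\<lambda>t. tensor k h (x(j := x j + t *\<^sub>R v))) has_vector_derivative tensor k h' x) (at 0)"
      using tensor_exp_sums_slot_derivative[OF h(1) d(2)] by blast
    then show ?case
      by (intro exI[of _ h']) (auto simp: h(2) d slot_deriv_def[THEN fun_cong, of "(j, v)"] vector_derivative_at)
  qed
  moreover have "continuous_on (power_space k) (tensor k h)"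
    if "\<forall>j<k. h j \<in> exp_sums" for h :: "nat \<Rightarrow> 'a \<Rightarrow> complex"
    unfolding tensor_def[abs_def]
  proof (intro continuous_on_prod)
    fix j assume "j \<in> {..<k}"
    then show "continuous_on (power_space k) (\<lambda>x. h j (x j))"
      using that
      by (intro continuous_on_compose2[OF continuous_on_exp_sums[of "h j" UNIV]]
          continuous_on_subset[OF continuous_on_product_coordinates]) auto
  qed
  moreover have "(\<lambda>t. tensor k h (x(j := x j + t *\<^sub>R v))) differentiable (at 0)"
    if "\<forall>j<k. h j \<in> exp_sums" "j < k" for h :: "nat \<Rightarrow> 'a \<Rightarrow> complex" and j v x
    using tensor_exp_sums_slot_derivative[OF that, of v] differentiableI_vector by blast
  ultimately show ?thesis
    unfolding smooth_power_def by metis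
qed

text \<open>Since \<open>T\<close> is linear on smooth functions, its value on a tensor product of
  combinations expands, slot by slot, into values on tensor products of generators.\<close>

lemma compact_distribution_tensor_vanish:
  assumes T: "compact_distribution k T"
    and B: "B \<subseteq> exp_sums"
    and 0: "\<And>g. (\<forall>j<k. g j \<in> B) \<Longrightarrow> T (tensor k g) = 0"
    and "\<forall>j<k. g j \<in> cspan B"
  shows "T (tensor k g) = 0"
proof -
  have smooth: "smooth_power k (tensor k g)" if "\<forall>j<k. g j \<in> cspan B" for g
    using that cspan_subset[OF B] by (intro smooth_power_tensor_exp_sums) blast
  have T_add: "T (\<lambda>x. \<phi> x + \<psi> x) = T \<phi> + T \<psi>" if "smooth_power k \<phi>" "smooth_power k \<psi>" for \<phi> \<psi>
    using T that by (auto simp: compact_distribution_def)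
  have T_scale: "T (\<lambda>x. c * \<phi> x) = c * T \<phi>" if "smooth_power k \<phi>" for c \<phi>
    using T that by (auto simp: compact_distribution_def)
  \<comment> \<open>Induction on the number \<open>m\<close> of slots that may carry combinations;
    all later slots hold generators.\<close>
  have "T (tensor k g) = 0"
    if "m \<le> k" "\<forall>j<m. g j \<in> cspan B" "\<forall>j<k. m \<le> j \<longrightarrow> g j \<in> B" for m g
    using that
  proof (induction m arbitrary: g)
    case 0
    then show ?case using assms(3) by auto
  next
    case (Suc m)
    have "T (tensor k (g(m := a))) = 0" if "a \<in> cspan B" for a
      using that
    proof induction
      case (base a)
      show ?case
        using Suc.prems base by (intro Suc.IH) auto
    next
      case (add a b)
      have "tensor k (g(m := (\<lambda>x. a x + b x))) =
          (\<lambda>x. tensor k (g(m := a)) x + tensor k (g(m := b)) x)"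
        using Suc.prems by (auto simp: tensor_upd distrib_right)
      \<comment> \<open>Linearity of \<open>T\<close> is only available on smooth functions. The
        slots after \<open>m\<close> qualify because generators lie in the span.\<close>
      moreover have "smooth_power k (tensor k (g(m := c)))" if "c \<in> cspan B" for c
        using Suc.prems that by (intro smooth) (auto intro: cspan.base simp: le_Suc_eq not_less_eq)
      ultimately show ?case using add.hyps add.IH by (simp only: T_add) simp
    next
      case (scale a c)
      have "tensor k (g(m := (\<lambda>x. c * a x))) = (\<lambda>x. c * tensor k (g(m := a)) x)"
        using Suc.prems by (auto simp: tensor_upd)
      moreover have "smooth_power k (tensor k (g(m := a)))"
        using Suc.prems scale by (intro smooth) (auto intro: cspan.base simp: le_Suc_eq not_less_eq)
      ultimately show ?case using scale.IH by (simp only: T_scale) simp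
    qed
    from this[of "g m"] show ?case using Suc.prems by simp
  qed
  from this[of k] show ?thesis using assms(4) by simp
qed

section \<open>Polarization\<close>

text \<open>\<open>F\<close> is controlled for nonnegative arguments only. A function
  \<open>g\<close> on the whole line that agrees with it there and is differentiable at 0 determines
  the one-sided derivative.\<close>

lemma right_partial0_eqI:
  assumes "\<And>t. t \<ge> 0 \<Longrightarrow> F (c(j := t)) = g t" "(g has_vector_derivative D) (at 0)"
  shows "right_partial0 j F c = D"
  unfolding right_partial0_def
proof (rule vector_derivative_within)
  show "at 0 within {0::real..} \<noteq> bot"
    by (simp add: at_within_Ici_at_right)
  show "((\<lambda>t. F (c(j := t))) has_vector_derivative D) (at 0 within {0..})"
    by (rule has_vector_derivative_transform[OF _ _ has_vector_derivative_at_within[OF assms(2)]])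
      (auto simp: assms(1))
qed

lemma foldr_right_partial0_zero:
  assumes "\<And>c. (\<forall>i. c i \<ge> 0) \<Longrightarrow> F c = 0" "\<forall>i. c i \<ge> 0"
  shows "foldr right_partial0 js F c = 0"
  using assms(2)
proof (induction js arbitrary: c)
  case Nil
  then show ?case using assms(1) by simp
next
  case (Cons j js)
  show ?case
    unfolding foldr_Cons o_apply
    by (rule right_partial0_eqI[where g = "\<lambda>_. 0"]) (use Cons in auto)
qed

text \<open>Each derivative removes its variable from the sum, lowers the exponent by one and
  contributes the old exponent as a factor; these factors accumulate to
  \<open>fact n / fact (n - length js)\<close>.\<close>

lemma foldr_right_partial0_power:
  assumes F: "\<And>c. (\<forall>i. c i \<ge> 0) \<Longrightarrow> F c = (\<Sum>i\<in>S. c i) ^ n * A"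
    and S: "finite S" "distinct js" "set js \<subseteq> S" "length js \<le> n" and c: "\<forall>i. c i \<ge> 0"
  shows "foldr right_partial0 js F c =
    (\<Sum>i\<in>S - set js. c i) ^ (n - length js) * (fact n / fact (n - length js) * A)"
  using S(2-) c
proof (induction js arbitrary: c)
  case Nil
  then show ?case using F by simp
next
  case (Cons j js)
  define m where "m = n - length (j # js)"
  define s where "s = (\<Sum>i\<in>S - set (j # js). c i)"
  \<comment> \<open>The bound on the length leaves a positive exponent before differentiating in
    \<open>j\<close>.\<close>
  have m: "n - length js = Suc m" using Cons.prems by (simp add: m_def)
  have eq: "foldr right_partial0 js F (c(j := t)) =
      (t + s) ^ Suc m * (fact n / fact (Suc m) * A)" if "t \<ge> 0" for t
  proof -
    define c' where "c' = c(j := t)"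
    have "(\<Sum>i\<in>S - set js. c' i) = t + s"
    proof -
      have "S - set js = insert j (S - set (j # js))" using Cons.prems by auto
      then have "(\<Sum>i\<in>S - set js. c' i) = (\<Sum>i\<in>insert j (S - set (j # js)). c' i)"
        by (rule sum.cong) simp
      also have "\<dots> = t + (\<Sum>i\<in>S - set (j # js). c' i)"
        using S(1) by (subst sum.insert) (auto simp: c'_def)
      also have "(\<Sum>i\<in>S - set (j # js). c' i) = s"
        unfolding s_def by (intro sum.cong) (auto simp: c'_def)
      finally show ?thesis .
    qed
    moreover have "\<forall>i. c' i \<ge> 0" using Cons.prems(4) that by (simp add: c'_def)
    ultimately have "foldr right_partial0 js F c' =
        (t + s) ^ Suc m * (fact n / fact (Suc m) * A)"
      using Cons.IH[of c'] Cons.prems(1-3) m by simp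
    then show ?thesis unfolding c'_def .
  qed
  have "((\<lambda>t. (t + s) ^ Suc m * (fact n / fact (Suc m) * A)) has_real_derivative
      s ^ m * (fact n / fact m * A)) (at 0)"
  proof -
    have "((\<lambda>t. (t + s) ^ Suc m * K) has_real_derivative real (Suc m) * s ^ m * K) (at 0)" for K
      by (rule derivative_eq_intros | simp)+
    moreover have "real (Suc m) * s ^ m * (fact n / fact (Suc m) * A) =
        s ^ m * (fact n / fact m * A)"
      by (simp only: fact_Suc of_nat_mult) (simp add: divide_simps del: of_nat_Suc)
    ultimately show ?thesis by metis
  qed
  then show ?case
    unfolding foldr_Cons o_apply m_def[symmetric] s_def[symmetric]
    by (intro right_partial0_eqI[where g = "\<lambda>t. (t + s) ^ Suc m * (fact n / fact (Suc m) * A)"] eq)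
      (auto simp: has_real_derivative_iff_has_vector_derivative)
qed

text \<open>By homogeneity \<open>\<mu>\<close> of the combination is the \<open>k\<close>-th power
  of the sum of the coefficients times \<open>\<mu> g\<close>. Its \<open>k\<close> derivatives give
  \<open>fact k * \<mu> g\<close>. For \<open>k = 0\<close> this rests on
  \<open>0 ^ 0 = 1\<close>.\<close>

lemma polarization_diagonal:
  assumes "\<mu> \<in> VConv_hom k" "g \<in> Conv UNIV"
  shows "polarization k \<mu> (\<lambda>_. g) = \<mu> g"
proof -
  have "\<mu> (\<lambda>x. \<Sum>i<k. c i * g x) = (\<Sum>i<k. c i) ^ k * \<mu> g" if "\<forall>i. c i \<ge> 0" for c :: "nat \<Rightarrow> real"
  proof -
    have "(\<Sum>i<k. c i) \<ge> 0" using that by (simp add: sum_nonneg)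
    then show ?thesis
      using assms by (simp add: VConv_hom_def flip: sum_distrib_right)
  qed
  from foldr_right_partial0_power[of "\<lambda>c. \<mu> (\<lambda>x. \<Sum>i<k. c i * g x)", OF this, of "[0..<k]"]
  show ?thesis
    by (simp add: polarization_def atLeast0LessThan)
qed

section \<open>Convex functions\<close>

text \<open>Resolves the definite description: existence is the orthogonal decomposition, and the
  difference of two candidates is orthogonal to itself.\<close>

lemma orth_proj_works:
  fixes E :: "'a::euclidean_space set"
  assumes "subspace E"
  shows "orth_proj E x \<in> E \<and> (\<forall>z\<in>E. orthogonal (x - orth_proj E x) z)"
  unfolding orth_proj_def
proof (rule theI')
  have E: "span E = E" using assms by simp
  obtain y z where "y \<in> span E" "\<And>w. w \<in> span E \<Longrightarrow> orthogonal z w" "x = y + z"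
    using orthogonal_subspace_decomp_exists[of E x] by blast
  then have "y \<in> E \<and> (\<forall>z\<in>E. orthogonal (x - y) z)" by (simp add: E)
  moreover have "y' = y"
    if y: "y \<in> E \<and> (\<forall>z\<in>E. orthogonal (x - y) z)" and y': "y' \<in> E \<and> (\<forall>z\<in>E. orthogonal (x - y') z)"
    for y y'
  proof -
    have "y' - y \<in> E" using y y' assms by (simp add: subspace_diff)
    then have "orthogonal (x - y) (y' - y)" "orthogonal (x - y') (y' - y)" using y y' by auto
    then have "(y' - y) \<bullet> (y' - y) = 0"
      by (simp add: orthogonal_def inner_diff_left)
    then show ?thesis by simp
  qed
  ultimately show "\<exists>!y. y \<in> E \<and> (\<forall>z\<in>E. orthogonal (x - y) z)" by blast
qed

lemma orth_proj_in: "subspace E \<Longrightarrow> orth_proj E x \<in> E"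
  using orth_proj_works by blast

lemma inner_orth_proj:
  assumes "subspace E" "v \<in> E"
  shows "v \<bullet> orth_proj E x = v \<bullet> x"
proof -
  have "v \<bullet> (x - orth_proj E x) = 0"
    using orth_proj_works[OF assms(1), of x] assms(2) by (metis inner_commute orthogonal_def)
  then show ?thesis by (simp add: inner_diff_right)
qed

text \<open>Self-adjointness of the projection: both sides equal the inner product of the two
  projections. It moves the projection from the argument of an exponential to its frequency.\<close>

lemma inner_orth_proj_commute:
  assumes "subspace E"
  shows "v \<bullet> orth_proj E x = orth_proj E v \<bullet> x"
  using inner_orth_proj[OF assms orth_proj_in[OF assms], of x v]
    inner_orth_proj[OF assms orth_proj_in[OF assms], of v x]
  by (simp add: inner_commute)

lemma linear_orth_proj:
  assumes "subspace E"
  shows "linear (orth_proj E)"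
proof (rule linearI)
  fix x y :: 'a and c
  have "\<forall>z. z \<bullet> orth_proj E (x + y) = z \<bullet> (orth_proj E x + orth_proj E y)"
    by (simp add: inner_orth_proj_commute[OF assms] inner_add_right)
  then show "orth_proj E (x + y) = orth_proj E x + orth_proj E y"
    by (simp only: vector_eq_ldot)
  have "\<forall>z. z \<bullet> orth_proj E (c *\<^sub>R x) = z \<bullet> (c *\<^sub>R orth_proj E x)"
    by (simp add: inner_orth_proj_commute[OF assms])
  then show "orth_proj E (c *\<^sub>R x) = c *\<^sub>R orth_proj E x"
    by (simp only: vector_eq_ldot)
qed

lemma convex_on_orth_proj:
  assumes "subspace E" "convex_on E f"
  shows "convex_on UNIV (f \<circ> orth_proj E)"
proof (rule convex_onI)
  fix t :: real and x y
  assume t: "0 < t" "t < 1"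
  show "(f \<circ> orth_proj E) ((1 - t) *\<^sub>R x + t *\<^sub>R y) \<le>
      (1 - t) * (f \<circ> orth_proj E) x + t * (f \<circ> orth_proj E) y"
    using convex_onD[OF assms(2), of t "orth_proj E x" "orth_proj E y"] t
    by (simp add: linear_add linear_scale linear_orth_proj orth_proj_in assms(1))
qed simp

text \<open>Reduces convexity to one real variable, where the second derivative test
  applies.\<close>

lemma convex_on_linesI:
  fixes g :: "'a::real_vector \<Rightarrow> real"
  assumes "\<And>x y. convex_on UNIV (\<lambda>t::real. g (x + t *\<^sub>R y))"
  shows "convex_on UNIV g"
proof (rule convex_onI)
  fix t :: real and x y :: 'a
  assume "0 < t" "t < 1"
  then have "g (x + ((1 - t) *\<^sub>R 0 + t *\<^sub>R 1) *\<^sub>R (y - x)) \<le>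
      (1 - t) * g (x + 0 *\<^sub>R (y - x)) + t * g (x + 1 *\<^sub>R (y - x))"
    by (intro convex_onD[OF assms]) auto
  then show "g ((1 - t) *\<^sub>R x + t *\<^sub>R y) \<le> (1 - t) * g x + t * g y"
    by (simp add: algebra_simps)
qed simp

text \<open>A hyperplane strictly separates the point \<open>(x0, f x0 - e)\<close> from the closed
  convex epigraph; solved for the last coordinate, it is the graph of the minorant.\<close>

lemma convex_on_affine_minorant:
  fixes f :: "'a::euclidean_space \<Rightarrow> real"
  assumes f: "convex_on UNIV f" and e: "e > 0"
  obtains v b where "\<And>x. v \<bullet> x + b \<le> f x" "v \<bullet> x0 + b > f x0 - e"
proof -
  have "continuous_on UNIV f" using f by (simp add: convex_on_continuous)
  then have "continuous_on UNIV (\<lambda>z :: 'a \<times> real. f (fst z))"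
    by (rule continuous_on_compose2) (auto intro: continuous_on_fst continuous_on_id)
  then have "closed {z :: 'a \<times> real. f (fst z) \<le> snd z}"
    by (intro closed_Collect_le continuous_on_snd continuous_on_id)
  then have "closed (epigraph UNIV f)" by (simp add: epigraph_def)
  moreover have "(x0, f x0 - e) \<notin> epigraph UNIV f" using e by (simp add: epigraph_def)
  ultimately obtain a c where a: "a \<bullet> (x0, f x0 - e) < c" "\<And>z. z \<in> epigraph UNIV f \<Longrightarrow> a \<bullet> z > c"
    using separating_hyperplane_closed_point[of "epigraph UNIV f"] convex_epigraphI[OF f] by blast
  obtain a1 a2 where a12: "a = (a1, a2)" by (cases a)
  have lt: "a1 \<bullet> x + a2 * f x > c" for x
    using a(2)[of "(x, f x)"] by (simp add: a12 epigraph_def)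
  have 0: "a1 \<bullet> x0 + a2 * (f x0 - e) < c" using a(1) by (simp add: a12)
  \<comment> \<open>The hyperplane is not vertical, because it separates two points over the same
    \<open>x0\<close>.\<close>
  then have "a2 * e > 0" using lt[of x0] by (simp add: algebra_simps)
  then have a2: "a2 > 0" using e by (simp add: zero_less_mult_iff)
  show ?thesis
  proof
    show "(- (1 / a2) *\<^sub>R a1) \<bullet> x + c / a2 \<le> f x" for x
      using lt[of x] a2 by (simp add: field_simps)
    show "(- (1 / a2) *\<^sub>R a1) \<bullet> x0 + c / a2 > f x0 - e"
      using 0 a2 by (simp add: field_simps)
  qed
qed

text \<open>The sets on which the minorant built at \<open>y\<close> lies within \<open>e\<close> of
  \<open>f\<close> are open and cover \<open>K\<close>; a finite subcover supplies the
  indices.\<close>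

lemma convex_on_finite_affine_minorants:
  fixes f :: "'a::euclidean_space \<Rightarrow> real"
  assumes f: "convex_on UNIV f" and K: "compact K" and e: "e > 0"
  obtains I :: "'a set" and v b where "finite I" "I \<noteq> {}"
    "\<And>i x. i \<in> I \<Longrightarrow> v i \<bullet> x + b i \<le> f x"
    "\<And>x. x \<in> K \<Longrightarrow> \<exists>i\<in>I. v i \<bullet> x + b i > f x - e"
proof -
  have "\<forall>y. \<exists>v b. (\<forall>x. v \<bullet> x + b \<le> f x) \<and> v \<bullet> y + b > f y - e"
    using convex_on_affine_minorant[OF f e] by metis
  then obtain v b where vb: "\<And>y x. v y \<bullet> x + b y \<le> f x" "\<And>y. v y \<bullet> y + b y > f y - e"
    by metis
  define U where "U y = {x. f x - e < v y \<bullet> x + b y}" for y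
  have "continuous_on UNIV f" using f by (simp add: convex_on_continuous)
  then have "open (U y)" for y
    unfolding U_def by (intro open_Collect_less continuous_intros)
  moreover have "K \<subseteq> (\<Union>y\<in>UNIV. U y)" using vb(2) by (auto simp: U_def)
  ultimately obtain I where I: "finite I" "K \<subseteq> (\<Union>y\<in>I. U y)"
    using compactE_image[OF K, of UNIV U] by auto
  show ?thesis
  proof
    \<comment> \<open>The extra index 0 keeps the family nonempty when \<open>K\<close> is
      empty.\<close>
    show "finite (insert 0 I)" "insert 0 I \<noteq> {}" using I by auto
    show "\<exists>i\<in>insert 0 I. v i \<bullet> x + b i > f x - e" if "x \<in> K" for x
      using I(2) that by (auto simp: U_def)
  qed (use vb in auto)
qed

section \<open>Truncated logarithms of sums of exponentials\<close>

text \<open>A truncated logarithm series composed with a sum of exponentials is convex because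
  \<open>u'\<^sup>2 \<le> u u''\<close> along lines and, for odd \<open>j\<close>, the function \<open>u P'(u) = 1 - (1 - u / M)\<^sup>j\<close> is
  nonnegative and increasing on \<open>u > 0\<close>.\<close>

definition log_poly :: "nat \<Rightarrow> real \<Rightarrow> real \<Rightarrow> real" where
  "log_poly j M u = ln M - (\<Sum>i=1..j. (1 - u / M) ^ i / real i)"

text \<open>Termwise differentiation yields a truncation of the geometric series of
  \<open>1 / u\<close> around \<open>M\<close>.\<close>

lemma log_poly_derivative:
  assumes "M > 0"
  shows "(log_poly j M has_real_derivative (\<Sum>i<j. (1 - u / M) ^ i) / M) (at u)"
proof -
  have "(\<Sum>i=1..j. real i * (1 - u / M) ^ (i - 1) * (- (1 / M)) / real i) =
      - (\<Sum>i<j. (1 - u / M) ^ i) / M"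
  proof -
    have "(\<Sum>i=1..j. real i * (1 - u / M) ^ (i - 1) * (- (1 / M)) / real i) =
        (\<Sum>i=1..j. - ((1 - u / M) ^ (i - 1) / M))"
      using assms by (intro sum.cong) (auto simp: field_simps)
    also have "\<dots> = (\<Sum>i<j. - ((1 - u / M) ^ i / M))"
      by (rule sum.reindex_bij_witness[of _ Suc "\<lambda>i. i - 1"]) auto
    finally show ?thesis by (simp add: sum_negf sum_divide_distrib)
  qed
  moreover have "(log_poly j M has_real_derivative
      0 - (\<Sum>i=1..j. real i * (1 - u / M) ^ (i - 1) * (- (1 / M)) / real i)) (at u)"
    unfolding log_poly_def[abs_def] using assms
    by (intro DERIV_diff DERIV_sum DERIV_const DERIV_cdivide)
      (auto intro!: derivative_eq_intros)
  ultimately show ?thesis by simp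
qed

lemma convex_log_poly_sum_exp:
  fixes v :: "'i \<Rightarrow> 'a::real_inner"
  assumes I: "finite I" and M: "M > 0" and j: "odd j"
  shows "convex_on UNIV (\<lambda>x. log_poly j M (\<Sum>i\<in>I. exp (v i \<bullet> x + b i)))"
proof (cases "I = {}")
  case True
  then show ?thesis by (simp add: convex_on_const)
next
  case False
  show ?thesis
  proof (rule convex_on_linesI)
    fix x y :: 'a
    define a where "a i = v i \<bullet> y" for i
    define c where "c i = v i \<bullet> x + b i" for i
    define u where "u t = (\<Sum>i\<in>I. exp (a i * t + c i))" for t
    define u' where "u' t = (\<Sum>i\<in>I. a i * exp (a i * t + c i))" for t
    define u'' where "u'' t = (\<Sum>i\<in>I. (a i)\<^sup>2 * exp (a i * t + c i))" for t
    have u: "(u has_real_derivative u' t) (at t)" for t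
      unfolding u_def[abs_def] u'_def
      by (intro DERIV_sum) (auto intro!: derivative_eq_intros)
    have u': "(u' has_real_derivative u'' t) (at t)" for t
      unfolding u'_def[abs_def] u''_def
      by (intro DERIV_sum) (auto intro!: derivative_eq_intros simp: power2_eq_square)
    have u_pos: "u t > 0" for t
      unfolding u_def using I False by (intro sum_pos) auto
    have u''_nonneg: "u'' t \<ge> 0" for t
      unfolding u''_def by (intro sum_nonneg) auto
    have CS: "(u' t)\<^sup>2 \<le> u t * u'' t" for t
    proof -
      \<comment> \<open>Half of each exponent goes into either factor of the Cauchy-Schwarz
        inequality.\<close>
      have e: "exp (a i * t + c i) = (exp ((a i * t + c i) / 2))\<^sup>2" for i
        by (simp flip: exp_double)
      have "(\<Sum>i\<in>I. exp ((a i * t + c i) / 2) * (a i * exp ((a i * t + c i) / 2)))\<^sup>2 \<le>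
          (\<Sum>i\<in>I. (exp ((a i * t + c i) / 2))\<^sup>2) * (\<Sum>i\<in>I. (a i * exp ((a i * t + c i) / 2))\<^sup>2)"
        by (rule Cauchy_Schwarz_ineq_sum)
      then show ?thesis
        unfolding u_def u'_def u''_def e
        by (simp add: power_mult_distrib power2_eq_square mult_ac)
    qed
    define p where "p s = (\<Sum>i<j. (1 - s / M) ^ i) / M" for s
    have "M \<noteq> 0" using M by simp
    define p' where "p' s = (\<Sum>i<j. real i * (1 - s / M) ^ (i - 1) * (- (1 / M))) / M" for s
    have p: "(log_poly j M has_real_derivative p s) (at s)" for s
      unfolding p_def by (rule log_poly_derivative[OF M])
    have p': "(p has_real_derivative p' s) (at s)" for s
      unfolding p_def[abs_def] p'_def
      by (intro DERIV_cdivide DERIV_sum) (auto intro!: derivative_eq_intros simp: \<open>M \<noteq> 0\<close>)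
    have sp: "s * p s = 1 - (1 - s / M) ^ j" for s
      using one_diff_power_eq[of "1 - s / M" j] by (simp add: p_def)
    \<comment> \<open>Differentiating \<open>s * p s\<close> by the product rule and from its closed
      form determines the sign of \<open>p s + s * p' s\<close> without evaluating
      \<open>p'\<close>; the exponent \<open>j - 1\<close> is even.\<close>
    have "((\<lambda>s. s * p s) has_real_derivative (p s + s * p' s)) (at s)" for s
      by (auto intro!: derivative_eq_intros p' simp: algebra_simps)
    moreover have "((\<lambda>s. s * p s) has_real_derivative real j * (1 - s / M) ^ (j - 1) / M) (at s)" for s
      unfolding sp using \<open>M \<noteq> 0\<close> by (auto intro!: derivative_eq_intros)
    ultimately have "p s + s * p' s = real j * (1 - s / M) ^ (j - 1) / M" for s
      using DERIV_unique by blast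
    then have pp': "p s + s * p' s \<ge> 0" for s
      using M j by (simp add: zero_le_even_power)
    have p_nonneg: "p s \<ge> 0" if "s > 0" for s
    proof -
      \<comment> \<open>Odd powers are monotone on the whole line, so the bound persists for large
        \<open>s\<close>, where \<open>1 - s / M\<close> is below \<open>-1\<close>.\<close>
      have "(1 - s / M) ^ j \<le> 1 ^ j"
        using M that by (intro power_mono_odd j) simp
      then have "s * p s \<ge> 0" by (simp add: sp)
      then show ?thesis using that by (simp add: zero_le_mult_iff)
    qed
    \<comment> \<open>This is the second derivative. Where \<open>p'\<close> is negative,
      \<open>CS\<close> replaces the square by \<open>u t * u'' t\<close>, and the sum
      \<open>p + u p'\<close> takes over.\<close>
    have "p' (u t) * (u' t)\<^sup>2 + p (u t) * u'' t \<ge> 0" for t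
    proof (cases "p' (u t) \<ge> 0")
      case True
      then show ?thesis using p_nonneg[OF u_pos] u''_nonneg by simp
    next
      case False
      then have "p' (u t) * (u' t)\<^sup>2 \<ge> p' (u t) * (u t * u'' t)"
        by (intro mult_left_mono_neg CS) simp
      moreover have "(p (u t) + u t * p' (u t)) * u'' t \<ge> 0"
        by (intro mult_nonneg_nonneg pp' u''_nonneg)
      ultimately show ?thesis by (simp add: algebra_simps)
    qed
    moreover have "((\<lambda>t. log_poly j M (u t)) has_real_derivative p (u t) * u' t) (at t)" for t
      by (rule DERIV_chain2[OF p u])
    moreover have "((\<lambda>t. p (u t) * u' t) has_real_derivative
        p' (u t) * (u' t)\<^sup>2 + p (u t) * u'' t) (at t)" for t
      by (rule derivative_eq_intros DERIV_chain2[OF p' u] u' refl)+ (simp add: power2_eq_square algebra_simps)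
    ultimately have "convex_on UNIV (\<lambda>t. log_poly j M (u t))"
      by (intro f''_ge0_imp_convex) auto
    then show "convex_on UNIV (\<lambda>t. log_poly j M (\<Sum>i\<in>I. exp (v i \<bullet> (x + t *\<^sub>R y) + b i)))"
      by (simp add: u_def a_def c_def inner_add_right mult_ac add_ac)
  qed
qed

text \<open>The error \<open>log_poly j M u - ln u\<close> decreases on \<open>(0, M]\<close> and
  vanishes at \<open>M\<close>, so on \<open>[m, M]\<close> it is largest at \<open>m\<close>.
  Convergence of the logarithm series at this one point is thus uniform.\<close>

lemma log_poly_approximates_ln:
  assumes m: "0 < m" "m \<le> M" and e: "e > 0"
  obtains j where "odd j" "\<And>u. m \<le> u \<Longrightarrow> u \<le> M \<Longrightarrow> \<bar>log_poly j M u - ln u\<bar> < e"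
proof -
  have M: "M > 0" using m by simp
  have mono: "log_poly j M t - ln t \<le> log_poly j M s - ln s"
    if st: "0 < s" "s \<le> t" "t \<le> M" for j s t
  proof (rule DERIV_nonpos_imp_nonincreasing[OF st(2)])
    fix w assume w: "s \<le> w" "w \<le> t"
    then have w': "0 < w" "w \<le> M" using st by auto
    have "((\<lambda>u. log_poly j M u - ln u) has_real_derivative (\<Sum>i<j. (1 - w / M) ^ i) / M - 1 / w) (at w)"
      using w' by (intro DERIV_diff log_poly_derivative M) (auto intro!: derivative_eq_intros)
    moreover have "w * ((\<Sum>i<j. (1 - w / M) ^ i) / M) = 1 - (1 - w / M) ^ j"
      using one_diff_power_eq[of "1 - w / M" j] by simp
    then have "w * ((\<Sum>i<j. (1 - w / M) ^ i) / M) \<le> 1"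
      using w' M by simp
    then have "(\<Sum>i<j. (1 - w / M) ^ i) / M - 1 / w \<le> 0"
      using w' by (simp add: field_simps)
    ultimately show "\<exists>y. ((\<lambda>u. log_poly j M u - ln u) has_real_derivative y) (at w) \<and> y \<le> 0"
      by blast
  qed
  have "(\<lambda>n. - ((- (- (1 - m / M))) ^ n) / real n) sums ln (1 + (- (1 - m / M)))"
    using m by (intro ln_series') (auto simp: abs_if field_simps)
  then have "(\<lambda>n. \<Sum>i<n. - ((1 - m / M) ^ i / real i)) \<longlonglongrightarrow> ln (m / M)"
    by (simp add: sums_def)
  then have "(\<lambda>n. ln M + (\<Sum>i<n. - ((1 - m / M) ^ i / real i))) \<longlonglongrightarrow> ln M + ln (m / M)"
    by (intro tendsto_intros)
  moreover have "ln M + ln (m / M) = ln m" using m by (simp add: ln_div)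
  ultimately obtain N where N: "\<And>n. n \<ge> N \<Longrightarrow>
      \<bar>ln M + (\<Sum>i<n. - ((1 - m / M) ^ i / real i)) - ln m\<bar> < e"
    using e unfolding LIMSEQ_iff real_norm_def by metis
  define j where "j = 2 * N + 1"
  \<comment> \<open>The series starts at 0, but its term there is a division by zero and hence
    0.\<close>
  have "ln M + (\<Sum>i<Suc j. - ((1 - m / M) ^ i / real i)) = log_poly j M m"
  proof -
    have "(\<Sum>i<Suc j. - ((1 - m / M) ^ i / real i)) = (\<Sum>i\<in>{1..j}. - ((1 - m / M) ^ i / real i))"
      by (intro sum.mono_neutral_right) auto
    then show ?thesis by (simp add: log_poly_def sum_negf)
  qed
  then have jm: "\<bar>log_poly j M m - ln m\<bar> < e" using N[of "Suc j"] by (simp add: j_def)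
  show ?thesis
  proof
    show "odd j" by (simp add: j_def)
    fix u assume u: "m \<le> u" "u \<le> M"
    have "log_poly j M u - ln u \<le> log_poly j M m - ln m" using mono m u by simp
    moreover have "log_poly j M M - ln M \<le> log_poly j M u - ln u" using mono m u by simp
    moreover have "log_poly j M M - ln M = 0" using M by (simp add: log_poly_def power_0_left)
    ultimately show "\<bar>log_poly j M u - ln u\<bar> < e" using jm by linarith
  qed
qed

text \<open>With \<open>n\<close> affine minorants, the scaled logarithm of the sum of the
  exponentials of \<open>t\<close> times the minorants exceeds their maximum by at most
  \<open>ln n / t\<close>. The errors are at most \<open>e / 2\<close> below and
  \<open>e / 4\<close> above, and less than \<open>e / 4\<close> from truncating the
  logarithm.\<close>

lemma convex_on_approx_log_poly_sum_exp:
  fixes f :: "'a::euclidean_space \<Rightarrow> real"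
  assumes f: "convex_on UNIV f" and K: "compact K" and e: "e > 0"
  obtains I :: "'a set" and v b M j r
  where "finite I" "I \<noteq> {}" "M > 0" "odd j" "r > 0"
    "\<And>x. x \<in> K \<Longrightarrow> \<bar>r * log_poly j M (\<Sum>i\<in>I. exp (v i \<bullet> x + b i)) - f x\<bar> < e"
proof -
  obtain I :: "'a set" and v b where I: "finite I" "I \<noteq> {}"
    and le: "\<And>i x. i \<in> I \<Longrightarrow> v i \<bullet> x + b i \<le> f x"
    and gt: "\<And>x. x \<in> K \<Longrightarrow> \<exists>i\<in>I. v i \<bullet> x + b i > f x - e / 2"
    using convex_on_finite_affine_minorants[OF f K half_gt_zero[OF e]] by blast
  \<comment> \<open>Chosen so that \<open>ln (card I) / t\<close> is at most \<open>e / 4\<close>;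
    the added 1 keeps \<open>t\<close> positive when there is a single index.\<close>
  define t where "t = 4 * (ln (real (card I)) + 1) / e"
  have card: "card I \<ge> 1" using I by (simp add: Suc_leI card_gt_0_iff)
  then have lncard: "ln (real (card I)) \<ge> 0" by simp
  then have t: "t > 0" using e by (simp add: t_def)
  have tln: "ln (real (card I)) / t \<le> e / 4"
    using lncard e by (simp add: t_def field_simps)
  define u where "u x = (\<Sum>i\<in>I. exp ((t *\<^sub>R v i) \<bullet> x + t * b i))" for x
  have u_pos: "u x > 0" for x unfolding u_def using I by (intro sum_pos) auto
  have lse: "\<bar>ln (u x) / t - f x\<bar> < 3 * e / 4" if x: "x \<in> K" for x
  proof -
    obtain i where i: "i \<in> I" "v i \<bullet> x + b i > f x - e / 2" using gt[OF x] by blast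
    have "exp (t * (f x - e / 2)) \<le> exp (t * (v i \<bullet> x + b i))" using i t by simp
    also have "\<dots> = exp ((t *\<^sub>R v i) \<bullet> x + t * b i)" by (simp add: algebra_simps)
    also have "\<dots> \<le> u x"
      unfolding u_def using I i by (intro member_le_sum) auto
    finally have "t * (f x - e / 2) \<le> ln (u x)" using u_pos by (simp add: ln_ge_iff)
    then have "f x - e / 2 \<le> ln (u x) / t" using t by (simp add: field_simps)
    moreover have "u x \<le> (\<Sum>i\<in>I. exp (t * f x))"
      unfolding u_def
    proof (rule sum_mono)
      fix i assume "i \<in> I"
      then have "t * (v i \<bullet> x + b i) \<le> t * f x" using le t by (intro mult_left_mono) auto
      then show "exp ((t *\<^sub>R v i) \<bullet> x + t * b i) \<le> exp (t * f x)" by (simp add: algebra_simps)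
    qed
    then have "ln (u x) \<le> ln (real (card I) * exp (t * f x))" using u_pos card by simp
    then have "ln (u x) \<le> ln (real (card I)) + t * f x" using card by (simp add: ln_mult)
    then have "ln (u x) / t \<le> (ln (real (card I)) + t * f x) / t"
      using t by (intro divide_right_mono) auto
    then have "ln (u x) / t \<le> ln (real (card I)) / t + f x"
      using t by (simp add: add_divide_distrib)
    ultimately show ?thesis using tln e by linarith
  qed
  have cont: "continuous_on K u" unfolding u_def by (intro continuous_intros)
  obtain m M where mM: "0 < m" "m \<le> M" and uK: "\<And>x. x \<in> K \<Longrightarrow> m \<le> u x \<and> u x \<le> M"
  proof (cases "K = {}")
    case True
    then show ?thesis using that[of 1 1] by auto
  next
    case False
    obtain y z where "y \<in> K" "\<And>x. x \<in> K \<Longrightarrow> u y \<le> u x" "z \<in> K" "\<And>x. x \<in> K \<Longrightarrow> u x \<le> u z"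
      using continuous_attains_inf[OF K False cont] continuous_attains_sup[OF K False cont] by metis
    then show ?thesis using that[of "u y" "u z"] u_pos by auto
  qed
  obtain j where j: "odd j" "\<And>w. m \<le> w \<Longrightarrow> w \<le> M \<Longrightarrow> \<bar>log_poly j M w - ln w\<bar> < t * e / 4"
    using log_poly_approximates_ln[OF mM, of "t * e / 4"] t e by auto
  have "\<bar>(1 / t) * log_poly j M (u x) - f x\<bar> < e" if x: "x \<in> K" for x
  proof -
    have "\<bar>log_poly j M (u x) - ln (u x)\<bar> / t < e / 4"
      using j(2)[of "u x"] uK[OF x] t by (simp add: field_simps)
    then have "\<bar>log_poly j M (u x) / t - ln (u x) / t\<bar> < e / 4"
      using t by (simp flip: diff_divide_distrib)
    then have "\<bar>log_poly j M (u x) / t - f x\<bar> < e"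
      using lse[OF x] unfolding abs_less_iff by linarith
    then show ?thesis by simp
  qed
  then show ?thesis
    using that[of I M j "1 / t" "\<lambda>i. t *\<^sub>R v i" "\<lambda>i. t * b i"] I mM j(1) t by (simp add: u_def)
qed

section \<open>Exponential sums with frequencies in a subspace\<close>

text \<open>These are the pairings of real vectors with the elements \<open>u + i v\<close> of the
  complexification of \<open>E\<close>, expressed without complex vectors.\<close>

definition complex_forms :: "'a::euclidean_space set \<Rightarrow> ('a \<Rightarrow> complex) set" where
  "complex_forms E = {\<lambda>x. Complex (u \<bullet> x) (v \<bullet> x) | u v. u \<in> E \<and> v \<in> E}"

lemma linear_Complex_inner: "linear (\<lambda>x. Complex (u \<bullet> x) (v \<bullet> x))"
  by (rule linearI) (auto simp: complex_eq_iff inner_add_right)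

lemma cspan_exps_complex_forms_subset: "cspan (exps (complex_forms E)) \<subseteq> exp_sums"
  by (intro cspan_exps_subset) (auto simp: complex_forms_def linear_Complex_inner)

lemma exps_complex_formsI: "u \<in> E \<Longrightarrow> v \<in> E \<Longrightarrow> (\<lambda>x. exp (Complex (u \<bullet> x) (v \<bullet> x))) \<in> exps (complex_forms E)"
  unfolding exps_def complex_forms_def
  by (intro CollectI exI[of _ "\<lambda>x. Complex (u \<bullet> x) (v \<bullet> x)"] exI[of _ u] exI[of _ v] conjI refl)

text \<open>Frequencies add under multiplication and \<open>E\<close> is closed under addition, so
  these exponential sums are closed under products, as needed to insert them into
  polynomials.\<close>

lemma cspan_exps_mult:
  assumes E: "subspace E"
    and "g \<in> cspan (exps (complex_forms E))" "h \<in> cspan (exps (complex_forms E))"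
  shows "(\<lambda>x. g x * h x) \<in> cspan (exps (complex_forms E))"
proof (rule cspan_mult[OF _ assms(2,3)])
  fix a b assume "a \<in> exps (complex_forms E)" "b \<in> exps (complex_forms E)"
  then obtain u v u' v' where uv: "u \<in> E" "v \<in> E" "u' \<in> E" "v' \<in> E"
    and ab: "a = (\<lambda>x. exp (Complex (u \<bullet> x) (v \<bullet> x)))" "b = (\<lambda>x. exp (Complex (u' \<bullet> x) (v' \<bullet> x)))"
    by (auto simp: exps_def complex_forms_def)
  have "(\<lambda>x. a x * b x) = (\<lambda>x. exp (Complex ((u + u') \<bullet> x) ((v + v') \<bullet> x)))"
    by (simp add: ab inner_add_left complex_add flip: exp_add)
  then show "(\<lambda>x. a x * b x) \<in> exps (complex_forms E)"
    using uv E by (simp add: exps_complex_formsI subspace_add)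
qed

lemma cspan_exps_const:
  assumes "subspace E"
  shows "(\<lambda>x. c) \<in> cspan (exps (complex_forms E))"
proof -
  have "(\<lambda>x. c * exp (Complex (0 \<bullet> x) (0 \<bullet> x))) \<in> cspan (exps (complex_forms E))"
    using subspace_0[OF assms] by (intro cspan.scale cspan.base exps_complex_formsI)
  then show ?thesis by (simp flip: zero_complex.code)
qed

lemma cspan_exps_power:
  assumes "subspace E" "g \<in> cspan (exps (complex_forms E))"
  shows "(\<lambda>x. g x ^ n) \<in> cspan (exps (complex_forms E))"
  by (induction n) (auto intro: cspan_exps_const[OF assms(1)] cspan_exps_mult[OF assms])

lemma cspan_diff:
  assumes "g \<in> cspan B" "h \<in> cspan B"
  shows "(\<lambda>x. g x - h x) \<in> cspan B"
  using cspan.add[OF assms(1) cspan.scale[OF assms(2), of "-1"]] by simp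

lemma cspan_exps_real_exp:
  assumes "subspace E" "v \<in> E"
  shows "(\<lambda>x. complex_of_real (exp (v \<bullet> x + b))) \<in> cspan (exps (complex_forms E))"
proof -
  have "(\<lambda>x. complex_of_real (exp b) * exp (Complex (v \<bullet> x) (0 \<bullet> x))) \<in> cspan (exps (complex_forms E))"
    using subspace_0[OF assms(1)] assms(2) by (intro cspan.scale cspan.base exps_complex_formsI)
  then show ?thesis
    by (simp add: exp_add mult.commute exp_of_real flip: complex_of_real_def)
qed

text \<open>\<open>log_poly j M\<close> is a polynomial, and the exponential sums with frequencies
  in \<open>E\<close> form an algebra containing the constants.\<close>

lemma cspan_exps_log_poly:
  fixes v :: "'i \<Rightarrow> 'a::euclidean_space"
  assumes E: "subspace E" and I: "finite I" "I \<noteq> {}" and v: "\<And>i. i \<in> I \<Longrightarrow> v i \<in> E"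
  shows "(\<lambda>x. complex_of_real (r * log_poly j M (\<Sum>i\<in>I. exp (v i \<bullet> x + b i))))
    \<in> cspan (exps (complex_forms E))" (is "_ \<in> ?X")
proof -
  have u: "(\<lambda>x. complex_of_real (\<Sum>i\<in>I. exp (v i \<bullet> x + b i))) \<in> ?X"
    unfolding of_real_sum by (intro cspan_sum I cspan_exps_real_exp[OF E] v)
  have "(\<lambda>x. 1 - complex_of_real (1 / M) * complex_of_real (\<Sum>i\<in>I. exp (v i \<bullet> x + b i))) \<in> ?X"
    by (intro cspan_diff cspan_exps_const[OF E] cspan.scale u)
  then have y: "(\<lambda>x. complex_of_real (1 - (\<Sum>i\<in>I. exp (v i \<bullet> x + b i)) / M)) \<in> ?X"
    by simp
  \<comment> \<open>For \<open>j = 0\<close> the sum is empty and \<open>cspan_sum\<close> does not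
    apply, so the zero function is treated as a constant.\<close>
  have "(\<lambda>x. complex_of_real (\<Sum>n=1..j. (1 - (\<Sum>i\<in>I. exp (v i \<bullet> x + b i)) / M) ^ n / real n)) \<in> ?X"
  proof (cases "j = 0")
    case True
    then show ?thesis using cspan_exps_const[OF E, of 0] by simp
  next
    case False
    have "(\<lambda>x. \<Sum>n=1..j. complex_of_real (1 / real n) *
        complex_of_real (1 - (\<Sum>i\<in>I. exp (v i \<bullet> x + b i)) / M) ^ n) \<in> ?X"
      using False by (intro cspan_sum cspan.scale cspan_exps_power[OF E y]) auto
    then show ?thesis by simp
  qed
  then have "(\<lambda>x. complex_of_real r * (complex_of_real (ln M) - complex_of_real
      (\<Sum>n=1..j. (1 - (\<Sum>i\<in>I. exp (v i \<bullet> x + b i)) / M) ^ n / real n))) \<in> ?X"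
    by (intro cspan.scale cspan_diff cspan_exps_const[OF E])
  then show ?thesis by (simp add: log_poly_def)
qed

text \<open>For a convex exponential sum \<open>h\<close> with frequencies in \<open>E\<close>,
  \<open>\<mu> h\<close> is the value of \<open>T\<close> on the tensor power of \<open>h\<close>,
  which expands to zero. Density and continuity of \<open>\<mu>\<close> extend this to all functions
  factoring through the projection.\<close>

lemma pushforward_vanish_if:
  assumes mu: "\<mu> \<in> VConv_hom k" and GW: "is_Goodey_Weil k \<mu> T" and E: "subspace E"
    and T: "\<And>g. (\<forall>j<k. g j \<in> exps (complex_forms E)) \<Longrightarrow> T (tensor k g) = 0"
    and f: "f \<in> Conv E"
  shows "pushforward E \<mu> f = 0"
proof -
  define X where "X = cspan (exps (complex_forms E))"
  have zero: "\<mu> h = 0" if h: "convex_on UNIV h" "(\<lambda>x. complex_of_real (h x)) \<in> X" for h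
  proof -
    have "smooth h"
      using smooth_Re_exp_sums[of "\<lambda>x. complex_of_real (h x)"] h(2) cspan_exps_complex_forms_subset
      unfolding X_def by auto
    then have "T (tensor k (\<lambda>i x. complex_of_real (h x))) = complex_of_real (polarization k \<mu> (\<lambda>_. h))"
      using GW h(1) by (simp add: is_Goodey_Weil_def Conv_def)
    moreover have "T (tensor k (\<lambda>i x. complex_of_real (h x))) = 0"
    proof (rule compact_distribution_tensor_vanish[where B = "exps (complex_forms E)"])
      show "compact_distribution k T" using GW by (simp add: is_Goodey_Weil_def)
      show "exps (complex_forms E) \<subseteq> exp_sums"
        using cspan_exps_complex_forms_subset by (auto intro: cspan.base)
    qed (use h(2) T in \<open>auto simp: X_def\<close>)
    ultimately show ?thesis
      using polarization_diagonal[OF mu] h(1) by (simp add: Conv_def)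
  qed
  define F where "F = f \<circ> orth_proj E"
  have F: "convex_on UNIV F"
    using f E by (simp add: F_def Conv_def convex_on_orth_proj)
  have idem: "orth_proj E (orth_proj E x) = orth_proj E x" for x
  proof -
    have "\<forall>z. z \<bullet> orth_proj E (orth_proj E x) = z \<bullet> orth_proj E x"
      by (metis E inner_orth_proj inner_orth_proj_commute orth_proj_in)
    then show ?thesis by (simp only: vector_eq_ldot)
  qed
  have "\<bar>\<mu> F\<bar> < e" if e: "e > 0" for e
  proof -
    have "continuous_map conv_topology euclideanreal \<mu>"
      using mu by (simp add: VConv_hom_def VConv_def)
    then have "openin conv_topology {h \<in> topspace conv_topology. \<mu> h \<in> ball (\<mu> F) e}"
      by (rule openin_continuous_map_preimage) simp
    then have "conv_open {h \<in> Conv UNIV. \<mu> h \<in> ball (\<mu> F) e}"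
      by (simp add: openin_conv_topology topspace_conv_topology)
    moreover have "F \<in> {h \<in> Conv UNIV. \<mu> h \<in> ball (\<mu> F) e}"
      using F e by (simp add: Conv_def)
    ultimately obtain K d where K: "compact K" "d > 0"
      and sub: "{h \<in> Conv UNIV. \<forall>x\<in>K. \<bar>h x - F x\<bar> < d} \<subseteq> {h \<in> Conv UNIV. \<mu> h \<in> ball (\<mu> F) e}"
      unfolding conv_open_def by meson
    \<comment> \<open>Both \<open>F\<close> and the approximant \<open>g\<close> below factor
      through the projection, so closeness on the projected compact set suffices.\<close>
    have image: "compact (orth_proj E ` K)"
      using linear_orth_proj[OF E] K(1)
      by (intro compact_continuous_image linear_continuous_on) (simp_all add: linear_conv_bounded_linear)
    obtain I :: "'a set" and v b M j r
      where I: "finite I" "I \<noteq> {}" and M: "M > 0" and j: "odd j" and r: "r > 0"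
        and approx: "\<And>x. x \<in> orth_proj E ` K \<Longrightarrow>
          \<bar>r * log_poly j M (\<Sum>i\<in>I. exp (v i \<bullet> x + b i)) - F x\<bar> < d"
      by (rule convex_on_approx_log_poly_sum_exp[OF F image K(2)]) (rule that)
    \<comment> \<open>Projecting the frequencies amounts to composing the approximant with the
      projection, and it keeps the function convex on the whole space.\<close>
    define g where "g x = r * log_poly j M (\<Sum>i\<in>I. exp (orth_proj E (v i) \<bullet> x + b i))" for x
    have "convex_on UNIV g"
      unfolding g_def[abs_def] using r by (intro convex_on_cmul convex_log_poly_sum_exp I M j) simp
    moreover have "\<bar>g x - F x\<bar> < d" if "x \<in> K" for x
      using approx[of "orth_proj E x"] that
      by (simp add: g_def F_def idem inner_orth_proj_commute[OF E])
    ultimately have "\<mu> g \<in> ball (\<mu> F) e" using sub by (auto simp: Conv_def)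
    moreover have "\<mu> g = 0"
    proof (rule zero)
      show "convex_on UNIV g" by fact
      show "(\<lambda>x. complex_of_real (g x)) \<in> X"
        unfolding X_def g_def by (intro cspan_exps_log_poly E I orth_proj_in)
    qed
    ultimately show ?thesis by (simp add: dist_real_def)
  qed
  \<comment> \<open>If \<open>\<mu> F\<close> were nonzero, its absolute value would be smaller than
    itself.\<close>
  from this[of "\<bar>\<mu> F\<bar>"] show ?thesis by (auto simp: pushforward_def F_def)
qed

section \<open>From a vanishing pushforward to vanishing on exponentials\<close>

text \<open>The Hessian of \<open>Re (c e\<^sup>l)\<close> for \<open>l = q + i p\<close> and \<open>\<bar>c\<bar> \<le> 1\<close> is bounded by that of
  \<open>3 e\<^sup>q (1 + e\<^sup>p + e\<^sup>-\<^sup>p)\<close>, so the exponential is a complex combination of smooth convex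
  exponential sums.\<close>

definition convex_majorant :: "'a::euclidean_space \<Rightarrow> 'a \<Rightarrow> 'a \<Rightarrow> real" where
  "convex_majorant u v x = 3 * (exp (u \<bullet> x) + exp ((u + v) \<bullet> x) + exp ((u - v) \<bullet> x))"

text \<open>One of \<open>exp p\<close> and \<open>exp (- p)\<close> is at least 1; the term with
  the other is dropped. After division by \<open>exp q\<close> this compares the second derivatives
  along a line.\<close>

lemma convex_majorant_quadratic:
  fixes a b p :: real
  shows "a\<^sup>2 + b\<^sup>2 \<le> 3 * (b\<^sup>2 + (b + a)\<^sup>2 * exp p + (b - a)\<^sup>2 * exp (- p))"
proof -
  have *: "a\<^sup>2 + b\<^sup>2 \<le> 3 * (b\<^sup>2 + (b + a)\<^sup>2)" for a :: real
    \<comment> \<open>The difference of the two sides is exactly the sum of these two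
      squares.\<close>
    using zero_le_power2[of "2 * b + a"] zero_le_power2[of "b + a"]
    by (simp add: power2_eq_square algebra_simps)
  show ?thesis
  proof (cases "p \<ge> 0")
    case True
    then have "(b + a)\<^sup>2 * 1 \<le> (b + a)\<^sup>2 * exp p" by (intro mult_left_mono) auto
    moreover have "(b - a)\<^sup>2 * exp (- p) \<ge> 0" by simp
    ultimately show ?thesis using *[of a] by argo
  next
    case False
    then have "(b - a)\<^sup>2 * 1 \<le> (b - a)\<^sup>2 * exp (- p)" by (intro mult_left_mono) auto
    moreover have "(b + a)\<^sup>2 * exp p \<ge> 0" by simp
    moreover have "a\<^sup>2 + b\<^sup>2 \<le> 3 * (b\<^sup>2 + (b - a)\<^sup>2)" using *[of "- a"] by simp
    ultimately show ?thesis by argo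
  qed
qed

lemma convex_Re_exp_add_majorant:
  assumes c: "cmod c \<le> 1"
  shows "convex_on UNIV (\<lambda>x. Re (c * exp (Complex (u \<bullet> x) (v \<bullet> x))) + convex_majorant u v x)"
proof (rule convex_on_linesI)
  fix x y :: 'a
  define b where "b = u \<bullet> y"
  define a where "a = v \<bullet> y"
  define q where "q t = u \<bullet> x + t * b" for t
  define p where "p t = v \<bullet> x + t * a" for t
  \<comment> \<open>Each differentiation along the line multiplies the complex exponential
    \<open>z\<close> by \<open>w\<close>.\<close>
  define w where "w = Complex b a"
  define z where "z t = exp (Complex (q t) (p t))" for t
  have z: "((\<lambda>t. Re (d * z t)) has_real_derivative Re (d * w * z t)) (at t)" for d t
  proof -
    have eq: "z = (\<lambda>t. exp (Complex (u \<bullet> x) (v \<bullet> x) + of_real t * w))"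
      unfolding z_def q_def p_def w_def
      by (intro ext arg_cong[of _ _ exp]) (simp add: complex_eq_iff)
    have "((\<lambda>t. d * exp (Complex (u \<bullet> x) (v \<bullet> x) + t * w)) has_field_derivative
        d * w * exp (Complex (u \<bullet> x) (v \<bullet> x) + of_real t * w)) (at (of_real t))"
      by (auto intro!: derivative_eq_intros)
    from bounded_linear.has_vector_derivative[OF bounded_linear_Re has_vector_derivative_real_field[OF this]]
    show ?thesis unfolding eq by (simp add: has_real_derivative_iff_has_vector_derivative)
  qed
  have e: "((\<lambda>t. exp (r + t * s)) has_real_derivative s * exp (r + t * s)) (at t)" for r s t :: real
    by (auto intro!: derivative_eq_intros)
  \<comment> \<open>\<open>h k\<close> is the \<open>k\<close>-th derivative of
    \<open>convex_majorant u v\<close> along the line.\<close>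
  define h where "h k t = 3 * (b ^ k * exp (q t) + (b + a) ^ k * exp ((u + v) \<bullet> x + t * (b + a)) +
      (b - a) ^ k * exp ((u - v) \<bullet> x + t * (b - a)))" for k t
  have h: "(h k has_real_derivative h (Suc k) t) (at t)" for k t
    unfolding h_def[abs_def] q_def
    by (rule derivative_eq_intros e refl)+ (simp add: algebra_simps)
  have "Re (c * w * w * z t) + h 2 t \<ge> 0" for t
  proof -
    have "\<bar>Re (c * w * w * z t)\<bar> \<le> cmod (c * w * w * z t)" by (rule abs_Re_le_cmod)
    also have "\<dots> = cmod c * ((cmod w)\<^sup>2 * exp (q t))"
      by (simp only: norm_mult z_def norm_exp_eq_Re complex.sel power2_eq_square mult.assoc)
    also have "(cmod w)\<^sup>2 = a\<^sup>2 + b\<^sup>2"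
      by (simp add: w_def cmod_power2)
    also have "cmod c * ((a\<^sup>2 + b\<^sup>2) * exp (q t)) \<le> 1 * ((a\<^sup>2 + b\<^sup>2) * exp (q t))"
      using c by (intro mult_right_mono) auto
    also have "\<dots> \<le> 3 * (b\<^sup>2 + (b + a)\<^sup>2 * exp (p t) + (b - a)\<^sup>2 * exp (- p t)) * exp (q t)"
      using convex_majorant_quadratic[of a b "p t"] by (simp add: mult_right_mono)
    also have "\<dots> = 3 * (b\<^sup>2 * exp (q t) + (b + a)\<^sup>2 * exp (q t + p t) + (b - a)\<^sup>2 * exp (q t - p t))"
      by (simp add: exp_add exp_diff exp_minus field_simps)
    also have "\<dots> = h 2 t"
      by (simp add: h_def q_def p_def algebra_simps)
    finally show ?thesis by linarith
  qed
  then have "convex_on UNIV (\<lambda>t. Re (c * z t) + h 0 t)"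
    using DERIV_add[OF z h] unfolding numeral_2_eq_2
    by (intro f''_ge0_imp_convex[where f' = "\<lambda>t. Re (c * w * z t) + h (Suc 0) t"
          and f'' = "\<lambda>t. Re (c * w * w * z t) + h (Suc (Suc 0)) t"]) blast+
  moreover have "Re (c * z t) + h 0 t = Re (c * exp (Complex (u \<bullet> (x + t *\<^sub>R y)) (v \<bullet> (x + t *\<^sub>R y)))) +
      convex_majorant u v (x + t *\<^sub>R y)" for t
    by (simp add: z_def q_def p_def h_def a_def b_def convex_majorant_def algebra_simps)
  ultimately show "convex_on UNIV (\<lambda>t. Re (c * exp (Complex (u \<bullet> (x + t *\<^sub>R y)) (v \<bullet> (x + t *\<^sub>R y)))) +
      convex_majorant u v (x + t *\<^sub>R y))"
    by simp
qed

text \<open>The real part is half the sum with the conjugate, and conjugating an exponential only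
  changes the sign of \<open>v\<close>.\<close>

lemma Re_exp_add_majorant_in_exp_sums:
  "(\<lambda>x. complex_of_real (Re (c * exp (Complex (u \<bullet> x) (v \<bullet> x))) + convex_majorant u v x)) \<in> exp_sums"
proof -
  note UNIV = cspan_exps_complex_forms_subset[of UNIV, THEN subsetD]
  have E: "(\<lambda>x. exp (Complex (u \<bullet> x) (v \<bullet> x))) \<in> exp_sums" for u v :: 'a
    by (intro UNIV cspan.base exps_complex_formsI) auto
  have R: "(\<lambda>x. complex_of_real (exp (u \<bullet> x))) \<in> exp_sums" for u :: 'a
    using UNIV[OF cspan_exps_real_exp[OF subspace_UNIV, of u 0]] by simp
  have "(\<lambda>x. (c / 2 * exp (Complex (u \<bullet> x) (v \<bullet> x)) + cnj c / 2 * exp (Complex (u \<bullet> x) ((- v) \<bullet> x))) +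
      3 * ((complex_of_real (exp (u \<bullet> x)) + complex_of_real (exp ((u + v) \<bullet> x))) +
        complex_of_real (exp ((u - v) \<bullet> x)))) \<in> exp_sums"
    by (intro cspan.add cspan.scale E R)
  moreover have "complex_of_real (Re (c * exp (Complex (u \<bullet> x) (v \<bullet> x)))) =
      c / 2 * exp (Complex (u \<bullet> x) (v \<bullet> x)) + cnj c / 2 * exp (Complex (u \<bullet> x) ((- v) \<bullet> x))" for x
  proof -
    have "exp (Complex (u \<bullet> x) ((- v) \<bullet> x)) = cnj (exp (Complex (u \<bullet> x) (v \<bullet> x)))"
      unfolding exp_cnj by (intro arg_cong[of _ _ exp]) (simp add: complex_eq_iff)
    moreover have "complex_of_real (Re (c * e)) = c / 2 * e + cnj c / 2 * cnj e" for e
      by (simp add: complex_eq_iff field_simps)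
    ultimately show ?thesis by (simp only:)
  qed
  ultimately show ?thesis by (simp add: convex_majorant_def)
qed

text \<open>On tensor products of convex exponential sums factoring through the projection,
  \<open>T\<close> is a polarization that evaluates \<open>\<mu>\<close> only at functions where the
  pushforward vanishes. The exponentials in question are combinations of such sums.\<close>

lemma tensor_exps_vanish_if:
  assumes GW: "is_Goodey_Weil k \<mu> T" and E: "subspace E"
    and mu: "\<And>f. f \<in> Conv E \<Longrightarrow> pushforward E \<mu> f = 0"
    and g: "\<forall>j<k. g j \<in> exps (complex_forms E)"
  shows "T (tensor k g) = 0"
proof -
  \<comment> \<open>Invariance under the projection passes to nonnegative combinations, so
    \<open>\<mu>\<close> of such a combination is a value of the pushforward.\<close>
  define B where "B = {\<lambda>x. complex_of_real (h x) | h.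
    convex_on UNIV h \<and> (\<lambda>x. complex_of_real (h x)) \<in> exp_sums \<and> h \<circ> orth_proj E = h}"
  have zero: "T (tensor k g) = 0" if g: "\<forall>j<k. g j \<in> B" for g
  proof -
    define h where "h j x = Re (g j x)" for j x
    have h: "convex_on UNIV (h j)" "smooth (h j)" "g j = (\<lambda>x. complex_of_real (h j x))"
      "\<And>x. h j (orth_proj E x) = h j x" if j: "j < k" for j
    proof -
      obtain h' where h': "g j = (\<lambda>x. complex_of_real (h' x))" "convex_on UNIV h'" "g j \<in> exp_sums"
        "h' \<circ> orth_proj E = h'"
        using g j by (auto simp: B_def)
      have "h j = h'" by (simp add: h'(1) h_def fun_eq_iff)
      then show "convex_on UNIV (h j)" "g j = (\<lambda>x. complex_of_real (h j x))"
        "\<And>x. h j (orth_proj E x) = h j x"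
        using h' by (auto dest: fun_cong)
      show "smooth (h j)"
        using smooth_Re_exp_sums[OF h'(3)] unfolding h_def[abs_def] .
    qed
    have "\<mu> (\<lambda>x. \<Sum>i<k. c i * h i x) = 0" if c: "\<forall>i. c i \<ge> 0" for c :: "nat \<Rightarrow> real"
    proof -
      have "convex_on UNIV (\<lambda>x. \<Sum>i\<in>{..<m}. c i * h i x)" if "m \<le> k" for m
        using that
        by (induction m) (use c in \<open>auto intro!: convex_on_add convex_on_cmul h(1) simp: convex_on_const\<close>)
      then have "convex_on E (\<lambda>x. \<Sum>i<k. c i * h i x)"
        using subspace_imp_convex[OF E] convex_on_subset by blast
      then have "pushforward E \<mu> (\<lambda>x. \<Sum>i<k. c i * h i x) = 0"
        by (intro mu) (simp add: Conv_def)
      moreover have "(\<lambda>x. \<Sum>i<k. c i * h i x) \<circ> orth_proj E = (\<lambda>x. \<Sum>i<k. c i * h i x)"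
        by (auto simp: h(4))
      ultimately show ?thesis by (simp add: pushforward_def)
    qed
    then have "polarization k \<mu> h = 0"
      unfolding polarization_def by (subst foldr_right_partial0_zero) auto
    moreover have "T (tensor k (\<lambda>i x. complex_of_real (h i x))) = complex_of_real (polarization k \<mu> h)"
      using GW h by (simp add: is_Goodey_Weil_def Conv_def)
    moreover have "tensor k g = tensor k (\<lambda>i x. complex_of_real (h i x))"
      by (intro tensor_cong h(3))
    ultimately show ?thesis by simp
  qed
  have sub: "exps (complex_forms E) \<subseteq> cspan B"
  proof
    fix l assume "l \<in> exps (complex_forms E)"
    then obtain u v where uv: "u \<in> E" "v \<in> E" and l: "l = (\<lambda>x. exp (Complex (u \<bullet> x) (v \<bullet> x)))"
      by (auto simp: exps_def complex_forms_def)
    have proj: "w \<bullet> orth_proj E x = w \<bullet> x" if "w \<in> {u, v, u + v, u - v}" for w x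
      using that uv E by (intro inner_orth_proj) (auto intro: subspace_add subspace_diff)
    define G where "G c x = Re (c * l x) + convex_majorant u v x" for c x
    have G: "(\<lambda>x. complex_of_real (G c x)) \<in> cspan B" if "cmod c \<le> 1" for c
    proof (rule cspan.base)
      have "convex_on UNIV (G c)" "(\<lambda>x. complex_of_real (G c x)) \<in> exp_sums"
        unfolding G_def[abs_def] l
        using convex_Re_exp_add_majorant[OF that] Re_exp_add_majorant_in_exp_sums by auto
      moreover have "G c \<circ> orth_proj E = G c"
        by (auto simp: G_def l convex_majorant_def proj)
      ultimately show "(\<lambda>x. complex_of_real (G c x)) \<in> B" unfolding B_def by blast
    qed
    \<comment> \<open>\<open>G 0\<close> is the majorant alone. Subtracting it from
      \<open>G 1\<close> and \<open>G (- \<i>)\<close> leaves the real and the imaginary part of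
      \<open>l\<close>.\<close>
    have "(\<lambda>x. (complex_of_real (G 1 x) - complex_of_real (G 0 x)) +
        \<i> * (complex_of_real (G (- \<i>) x) - complex_of_real (G 0 x))) \<in> cspan B"
      by (intro cspan.add cspan.scale cspan_diff G) auto
    moreover have "l = (\<lambda>x. (complex_of_real (G 1 x) - complex_of_real (G 0 x)) +
        \<i> * (complex_of_real (G (- \<i>) x) - complex_of_real (G 0 x)))"
      by (auto simp: G_def fun_eq_iff complex_eq_iff)
    ultimately show "l \<in> cspan B" by simp
  qed
  have B: "B \<subseteq> exp_sums" by (auto simp: B_def)
  have T: "compact_distribution k T" using GW by (simp add: is_Goodey_Weil_def)
  have "\<forall>j<k. g j \<in> cspan B" using g sub by blast
  then show ?thesis
    using compact_distribution_tensor_vanish[where k = k and T = T and B = B and g = g] T B zero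
    by blast
qed

section \<open>The Fourier-Laplace transform on the complexification\<close>

lemma bilin_embed: "bilin (embed u + \<i> *s embed v) (embed x) = Complex (u \<bullet> x) (v \<bullet> x)"
proof -
  have "bilin (embed u + \<i> *s embed v) (embed x) =
      (\<Sum>a\<in>UNIV. complex_of_real (u $ a * x $ a) + \<i> * complex_of_real (v $ a * x $ a))"
    unfolding bilin_def embed_def by (intro sum.cong) (simp_all add: algebra_simps)
  then show ?thesis
    by (simp only: sum.distrib inner_vec_def Complex_eq of_real_sum inner_real_def sum_distrib_left)
qed

text \<open>Multiplication by \<open>- \<i>\<close> sends the frequency \<open>u + i v\<close> to
  \<open>v - i u\<close>, and \<open>E\<close> is closed under negation. The exponentials in the
  transform are therefore exactly those with forms in \<open>complex_forms E\<close>.\<close>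

lemma Fourier_Laplace_vanishes_iff:
  fixes E :: "(real ^ 'n) set"
  assumes E: "subspace E"
  shows "(\<forall>w. (\<forall>j<k. w j \<in> complexification E) \<longrightarrow> Fourier_Laplace k T w = 0) \<longleftrightarrow>
    (\<forall>g. (\<forall>j<k. g j \<in> exps (complex_forms E)) \<longrightarrow> T (tensor k g) = 0)" (is "?L \<longleftrightarrow> ?R")
proof
  have eq: "- \<i> * bilin (embed u + \<i> *s embed v) (embed x) = Complex (v \<bullet> x) ((- u) \<bullet> x)" for u v x :: "real ^ 'n"
    unfolding bilin_embed by (simp add: complex_eq_iff)
  show ?R if L: ?L
  proof (intro allI impI)
    fix g :: "nat \<Rightarrow> real ^ 'n \<Rightarrow> complex"
    assume "\<forall>j<k. g j \<in> exps (complex_forms E)"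
    then have "\<forall>j. \<exists>u v. j < k \<longrightarrow> u \<in> E \<and> v \<in> E \<and> g j = (\<lambda>x. exp (Complex (u \<bullet> x) (v \<bullet> x)))"
      by (force simp: exps_def complex_forms_def)
    then obtain u v where uv: "\<And>j. j < k \<Longrightarrow> u j \<in> E" "\<And>j. j < k \<Longrightarrow> v j \<in> E"
      "\<And>j. j < k \<Longrightarrow> g j = (\<lambda>x. exp (Complex (u j \<bullet> x) (v j \<bullet> x)))"
      by metis
    \<comment> \<open>The frequency is \<open>i (u + i v) = - v + i u\<close>, which the factor
      \<open>- \<i>\<close> turns back into \<open>u + i v\<close>.\<close>
    have "embed (- v j) + \<i> *s embed (u j) \<in> complexification E" if "j < k" for j
      using uv(1,2)[OF that] subspace_neg[OF E] unfolding complexification_def by blast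
    then have "Fourier_Laplace k T (\<lambda>j. embed (- v j) + \<i> *s embed (u j)) = 0"
      using spec[OF L, of "\<lambda>j. embed (- v j) + \<i> *s embed (u j)"] by simp
    then show "T (tensor k g) = 0"
      unfolding Fourier_Laplace_def eq using tensor_cong[of k g, OF uv(3)] by simp
  qed
  show ?L if R: ?R
  proof (intro allI impI)
    fix w :: "nat \<Rightarrow> complex ^ 'n"
    assume w: "\<forall>j<k. w j \<in> complexification E"
    have "(\<lambda>x. exp (- \<i> * bilin (w j) (embed x))) \<in> exps (complex_forms E)" if j: "j < k" for j
    proof -
      obtain u v where uv: "w j = embed u + \<i> *s embed v" "u \<in> E" "v \<in> E"
        using w j by (auto simp: complexification_def)
      show ?thesis
        unfolding uv(1) eq using uv(2,3) subspace_neg[OF E] by (intro exps_complex_formsI)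
    qed
    then show "Fourier_Laplace k T w = 0"
      unfolding Fourier_Laplace_def
      using spec[OF R, of "\<lambda>j x. exp (- \<i> * bilin (w j) (embed x))"] by simp
  qed
qed

theorem corollary2p7:
  fixes \<mu> :: "((real ^ 'n) \<Rightarrow> real) \<Rightarrow> real"
    and E :: "(real ^ 'n) set"
    and k :: nat
    and T :: "((nat \<Rightarrow> real ^ 'n) \<Rightarrow> complex) \<Rightarrow> complex"
  assumes "\<mu> \<in> VConv_hom k"
    and "is_Goodey_Weil k \<mu> T"
    and "subspace E"
    and "dim E = k"
  shows "(\<forall>w. (\<forall>j<k. w j \<in> complexification E) \<longrightarrow> Fourier_Laplace k T w = 0) \<longleftrightarrow>
         (\<forall>f\<in>Conv E. pushforward E \<mu> f = 0)"
  unfolding Fourier_Laplace_vanishes_iff[OF assms(3)]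
  using pushforward_vanish_if[OF assms(1-3)] tensor_exps_vanish_if[OF assms(2,3)] by blast

end
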